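(* Let $\omega$ be a unitary character of $Z_M(F)$, let $\sigma\in\Pi_{\mathrm{disc}}(M(F),\omega)$, and let $\xi$ be a regular function on $\Omega(\sigma)$ such that $\xi(z)$ vanishes for every $z\in\Omega(\sigma)\cap\Pi_{\mathrm{disc}}(M(F),\omega)$ unless $z\simeq\sigma$. Suppose $\xi(\sigma)=1$. Let $\phi_{\sigma,\xi}\in C^\infty_c(M(F))$ be a generalized pseudo-coefficient for $\sigma$ and $\xi$. Then the projection $\phi^\omega_{\sigma,\xi}\in C^\infty_c(M(F),\omega^{-1})$, $\phi^\omega_{\sigma,\xi}(m)=\int_{Z_M(F)}\omega(z)\phi_{\sigma,\xi}(zm)\,dz$, is a pseudo-coefficient of $\sigma$.
   Context: $F$ is a $p$-adic field of characteristic $0$ (a finite extension of $\mathbb{Q}_p$) with normalized absolute value $|\cdot|_F$. $G$ is a connected reductive group over $F$, and $M$ is a standard $F$-Levi subgroup of $G$ (possibly $M=G$), with center $Z_M$ and split component $A_M$ (the maximal $F$-split torus in $Z_M$) of dimension $d$. $C^\infty_c(M(F))$ is the space of locally constant compactly supported complex functions on $M(F)$; $C^\infty_c(M(F),\omega^{-1})$ is the space of locally constant functions on $M(F)$ compactly supported modulo $Z_M(F)$ and transforming under $Z_M(F)$ by $\omega^{-1}$. Haar measures $dm$ on $M(F)$ and $dz$ on $Z_M(F)$ are fixed. $\mathrm{trace}(\pi)(h)$ is the trace of $\int_{M(F)}h(m)\pi(m)\,dm$ for $h\in C^\infty_c(M(F))$, and the trace of $\int_{M(F)/Z_M(F)}h(m)\pi(m)\,d\bar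 m$ (quotient measure) for $h\in C^\infty_c(M(F),\omega^{-1})$ and $\pi$ with central character $\omega$. $\Pi_{\mathrm{temp}}(M(F))$ is the set of equivalence classes of irreducible tempered representations; $\Pi_{\mathrm{temp}}(M(F),\omega)$ and $\Pi_{\mathrm{disc}}(M(F),\omega)$ are the sets of equivalence classes of irreducible tempered, resp. discrete series (irreducible unitary, with matrix coefficients square-integrable modulo the center), representations with central character $\omega$. $M(F)^1=\{m\in M(F): |\chi(m)|_F=1 \text{ for all } F\text{-rational characters } \chi \text{ of } M\}$; $\Psi(M)=\mathrm{Hom}(M(F)/M(F)^1,\mathbb{C}^\times)$. Since $M(F)/M(F)^1\simeq\mathbb{Z}^d$, $\Psi(M)\simeq(\mathbb{C}^\times)^d$, and regular functions on $\Psi(M)$ are those corresponding to Laurent polynomials. $\Omega(\sigma)=\{\sigma\otimes\psi:\psi\in\Psi(M)\}$; $\xi:\Omega(\sigma)\to\mathbb{C}$ is regular if $\psi\mapsto\xi(\sigma\otimes\psi)$ is regular on $\Psi(M)$. A generalized pseudo-coefficient for $\sigma$ and $\xi$ is a function $\phi_{\sigma,\xi}\in C^\infty_c(M(F))$ such that for all $\pi\in\Pi_{\mathrm{temp}}(M(F))$, $\mathrm{trace}(\pi)(\phi_{\sigma,\xi})=\xi(\pi)$ if $\pi\simeq\sigma\otimes\psi$ for some $\psi\in\Psi(M)$, and $=0$ otherwise. For $\delta\in\Pi_{\mathrm{disc}}(M(F),\omega)$, a function $\phi^\omega_\delta\in C^\infty_c(M(F),\omega^{-1})$ is a pseudo-coefficient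 of $\delta$ if for all $\pi\in\Pi_{\mathrm{temp}}(M(F),\omega)$, $\mathrm{trace}(\pi)(\phi^\omega_\delta)=1$ if $\pi\simeq\delta$ and $=0$ otherwise. *)

theory Defs
  imports
    "HOL-Analysis.Analysis"
    "HOL-Algebra.Algebraic_Closure_Type"
    "HOL-Algebra.Solvable_Groups"
    "HOL-Algebra.Free_Abelian_Groups"
begin

section \<open>p-adic fields of characteristic 0\<close>

text \<open>
  The closure of the prime field in a complete field with an ultrametric absolute value
  satisfying |p| < 1 is the field of p-adic numbers.  So the fifth axiom says that the field is a
  finite extension of it: \<open>B\<close> is a finite spanning set, and the coefficients \<open>c b\<close> are limits of
  rational numbers.  The last axiom normalizes the
  absolute value: a uniformizer has absolute value 1/q, q being the cardinality of the residue
  field (the closed unit ball modulo the open one).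
\<close>

class padic_field = field_char_0 + complete_space +
  fixes absF :: "'a \<Rightarrow> real"
  assumes dist_absF: "dist x y = absF (x - y)"
    and absF_mult: "absF (x * y) = absF x * absF y"
    and absF_ultrametric: "absF (x + y) \<le> max (absF x) (absF y)"
    and absF_prime: "\<exists>p::nat. Factorial_Ring.prime p \<and> absF (of_nat p) < 1"
    and finite_over_Qp: "\<exists>B. finite B \<and>
      (\<forall>x. \<exists>c. (\<forall>b\<in>B. \<forall>\<epsilon>>0. \<exists>k l. dist (c b) (of_int k / of_int l) < \<epsilon>) \<and>
             x = (\<Sum>b\<in>B. c b * b))"
    and absF_normalized: "\<exists>u.
      absF u = 1 / real (card ({x. absF x \<le> 1} //
                 {(x, y). absF x \<le> 1 \<and> absF y \<le> 1 \<and> absF (x - y) < 1})) \<and>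
      (\<forall>x. x \<noteq> 0 \<longrightarrow> (\<exists>k::int. absF x = absF u powi k))"


section \<open>Linear algebraic groups over F\<close>

text \<open>
  A linear algebraic group is identified with its group of points over the algebraic closure of F,
  a Zariski closed subgroup of some GL(n).  As F is perfect, a closed subgroup is defined over F
  iff it is closed in the Zariski F-topology.
\<close>

inductive_set gen_algebra :: "'k::comm_ring_1 set \<Rightarrow> ('x \<Rightarrow> 'k) set \<Rightarrow> ('x \<Rightarrow> 'k) set"
  for R S where
  const: "c \<in> R \<Longrightarrow> (\<lambda>_. c) \<in> gen_algebra R S"
| gen: "f \<in> S \<Longrightarrow> f \<in> gen_algebra R S"
| add: "f \<in> gen_algebra R S \<Longrightarrow> g \<in> gen_algebra R S \<Longrightarrow> (\<lambda>x. f x + g x) \<in> gen_algebra R S"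
| mult: "f \<in> gen_algebra R S \<Longrightarrow> g \<in> gen_algebra R S \<Longrightarrow> (\<lambda>x. f x * g x) \<in> gen_algebra R S"

definition regular_funs :: "'k::field set \<Rightarrow> ('k^'n^'n \<Rightarrow> 'k) set" where
  "regular_funs R = gen_algebra R ({\<lambda>g. g $ i $ j |i j. True} \<union> {\<lambda>g. inverse (det g)})"

definition laurent_funs :: "'k::field set \<Rightarrow> nat \<Rightarrow> ((nat \<Rightarrow> 'k) \<Rightarrow> 'k) set" where
  "laurent_funs R d = gen_algebra R ({\<lambda>t. t l |l. l < d} \<union> {\<lambda>t. inverse (t l) |l. l < d})"

abbreviation base_field :: "'f::field alg_closure set" where
  "base_field \<equiv> range to_ac"

definition zariski :: "'k::field set \<Rightarrow> ('k^'n^'n) topology" where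
  "zariski R = topology_generated_by {{g. invertible g \<and> f g \<noteq> 0} |f. f \<in> regular_funs R}"

definition mat_group :: "('a::semiring_1^'n^'n) set \<Rightarrow> ('a^'n^'n) monoid" where
  "mat_group H = \<lparr>carrier = H, monoid.mult = (**), one = mat 1\<rparr>"

definition alg_subgroup :: "'k::field set \<Rightarrow> ('k^'n^'n) set \<Rightarrow> bool" where
  "alg_subgroup R H \<longleftrightarrow> subgroup H (mat_group {g. invertible g}) \<and> closedin (zariski R) H"

definition connected_alg :: "('k::field^'n^'n) set \<Rightarrow> bool" where
  "connected_alg H \<longleftrightarrow> alg_subgroup UNIV H \<and> connectedin (zariski UNIV) H"

definition unipotent :: "('k::field^'n^'n) set \<Rightarrow> bool" where
  "unipotent H \<longleftrightarrow> (\<forall>u\<in>H. \<exists>r. (((**) (u - mat 1)) ^^ r) (mat 1) = 0)"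

definition unipotent_radical :: "('k::field^'n^'n) set \<Rightarrow> ('k^'n^'n) set \<Rightarrow> bool" where
  "unipotent_radical H U \<longleftrightarrow>
     U \<lhd> mat_group H \<and> connected_alg U \<and> unipotent U \<and>
     (\<forall>U'. U' \<lhd> mat_group H \<and> connected_alg U' \<and> unipotent U' \<longrightarrow> U' \<subseteq> U)"

definition connected_reductive :: "('f::field alg_closure^'n^'n) set \<Rightarrow> bool" where
  "connected_reductive G \<longleftrightarrow>
     alg_subgroup base_field G \<and> connected_alg G \<and> unipotent_radical G {mat 1}"

definition borel_subgroup :: "('k::field^'n^'n) set \<Rightarrow> ('k^'n^'n) set \<Rightarrow> bool" where
  "borel_subgroup G B \<longleftrightarrow>
     B \<subseteq> G \<and> connected_alg B \<and> solvable (mat_group B) \<and>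
     (\<forall>B'. B \<subseteq> B' \<and> B' \<subseteq> G \<and> connected_alg B' \<and> solvable (mat_group B') \<longrightarrow> B' = B)"

definition F_parabolic ::
    "('f::field alg_closure^'n^'n) set \<Rightarrow> ('f alg_closure^'n^'n) set \<Rightarrow> bool" where
  "F_parabolic G P \<longleftrightarrow>
     alg_subgroup base_field P \<and> P \<subseteq> G \<and> (\<exists>B. borel_subgroup G B \<and> B \<subseteq> P)"

definition minimal_F_parabolic ::
    "('f::field alg_closure^'n^'n) set \<Rightarrow> ('f alg_closure^'n^'n) set \<Rightarrow> bool" where
  "minimal_F_parabolic G P \<longleftrightarrow>
     F_parabolic G P \<and> (\<forall>P'. F_parabolic G P' \<and> P' \<subseteq> P \<longrightarrow> P' = P)"

definition F_levi ::
    "('f::field alg_closure^'n^'n) set \<Rightarrow> ('f alg_closure^'n^'n) set \<Rightarrow> bool" where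
  "F_levi P M \<longleftrightarrow>
     alg_subgroup base_field M \<and> M \<subseteq> P \<and>
     (\<exists>U. unipotent_radical P U \<and> M \<inter> U = {mat 1} \<and> P = {m ** u |m u. m \<in> M \<and> u \<in> U})"

text \<open>Standardness is relative to a minimal parabolic \<open>P0\<close> and a Levi component \<open>M0\<close> of it.\<close>

definition standard_F_levi ::
    "('f::field alg_closure^'n^'n) set \<Rightarrow> ('f alg_closure^'n^'n) set \<Rightarrow>
     ('f alg_closure^'n^'n) set \<Rightarrow> ('f alg_closure^'n^'n) set \<Rightarrow> bool" where
  "standard_F_levi G P0 M0 M \<longleftrightarrow>
     minimal_F_parabolic G P0 \<and> F_levi P0 M0 \<and>
     (\<exists>P. F_parabolic G P \<and> P0 \<subseteq> P \<and> F_levi P M \<and> M0 \<subseteq> M)"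

definition center_of :: "('a::semiring_1^'n^'n) set \<Rightarrow> ('a^'n^'n) set" where
  "center_of H = {z \<in> H. \<forall>h\<in>H. z ** h = h ** z}"

text \<open>
  An F-split torus of dimension d: an F-subgroup together with an isomorphism \<open>\<tau>\<close> over F from the
  d-th power of the multiplicative group, with inverse given by the functions \<open>\<eta> 0, \<dots>, \<eta> (d - 1)\<close>.
\<close>

definition split_torus :: "('f::field alg_closure^'n^'n) set \<Rightarrow> nat \<Rightarrow> bool" where
  "split_torus A d \<longleftrightarrow>
     alg_subgroup base_field A \<and>
     (\<exists>\<tau> \<eta>. bij_betw \<tau> (PiE {..<d} (\<lambda>_. - {0})) A \<and>
       (\<forall>s\<in>PiE {..<d} (\<lambda>_. - {0}). \<forall>t\<in>PiE {..<d} (\<lambda>_. - {0}).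
          \<tau> (\<lambda>l\<in>{..<d}. s l * t l) = \<tau> s ** \<tau> t) \<and>
       (\<forall>i j. (\<lambda>t. \<tau> t $ i $ j) \<in> laurent_funs base_field d) \<and>
       (\<forall>l<d. \<eta> l \<in> regular_funs base_field \<and>
          (\<forall>t\<in>PiE {..<d} (\<lambda>_. - {0}). \<eta> l (\<tau> t) = t l)))"

definition split_component ::
    "('f::field alg_closure^'n^'n) set \<Rightarrow> ('f alg_closure^'n^'n) set \<Rightarrow> nat \<Rightarrow> bool" where
  "split_component M A d \<longleftrightarrow>
     split_torus A d \<and> A \<subseteq> center_of M \<and>
     (\<forall>A' d'. split_torus A' d' \<and> A \<subseteq> A' \<and> A' \<subseteq> center_of M \<longrightarrow> A' = A)"

definition rational_characters ::
    "('f::field alg_closure^'n^'n) set \<Rightarrow> ('f alg_closure^'n^'n \<Rightarrow> 'f alg_closure) set" where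
  "rational_characters M =
     {\<eta> \<in> regular_funs base_field.
        (\<forall>x\<in>M. \<eta> x \<noteq> 0) \<and> (\<forall>x\<in>M. \<forall>y\<in>M. \<eta> (x ** y) = \<eta> x * \<eta> y)}"

definition F_points :: "('f::field alg_closure^'n^'n) set \<Rightarrow> ('f^'n^'n) set" where
  "F_points H = {m. map_matrix to_ac m \<in> H}"

definition F_points1 :: "('f::padic_field alg_closure^'n^'n) set \<Rightarrow> ('f^'n^'n) set" where
  "F_points1 M =
     {m \<in> F_points M. \<forall>\<eta>\<in>rational_characters M. absF (of_ac (\<eta> (map_matrix to_ac m))) = 1}"


section \<open>Haar measures and function spaces\<close>

text \<open>
  Below, \<open>H\<close> and \<open>Z\<close> stand for the group of F-points of M and of its centre, with the subspace
  topology coming from the space of matrices over F.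
\<close>

definition haar_measure :: "('f::padic_field^'n^'n) set \<Rightarrow> ('f^'n^'n) measure \<Rightarrow> bool" where
  "haar_measure H \<mu> \<longleftrightarrow>
     space \<mu> = H \<and> sets \<mu> = sets (restrict_space borel H) \<and>
     (\<forall>K\<subseteq>H. compact K \<longrightarrow> emeasure \<mu> K < \<infinity>) \<and>
     (\<forall>U. openin (top_of_set H) U \<and> U \<noteq> {} \<longrightarrow> emeasure \<mu> U > 0) \<and>
     (\<forall>g\<in>H. \<forall>S\<in>sets \<mu>. emeasure \<mu> ((**) g ` S) = emeasure \<mu> S)"

definition locally_constant_on :: "('a::topological_space) set \<Rightarrow> ('a \<Rightarrow> 'b) \<Rightarrow> bool" where
  "locally_constant_on H f \<longleftrightarrow>
     (\<forall>x\<in>H. \<exists>U. openin (top_of_set H) U \<and> x \<in> U \<and> (\<forall>y\<in>U. f y = f x))"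

text \<open>Functions on \<open>H\<close> are total functions whose values outside \<open>H\<close> are irrelevant.\<close>

definition Cc_inf :: "('f::padic_field^'n^'n) set \<Rightarrow> ('f^'n^'n \<Rightarrow> complex) set" where
  "Cc_inf H = {h. locally_constant_on H h \<and>
     (\<exists>K\<subseteq>H. compact K \<and> (\<forall>m\<in>H. h m \<noteq> 0 \<longrightarrow> m \<in> K))}"

text \<open>The equivariance below is with respect to the inverse of \<open>\<omega>\<close>.\<close>

definition Cc_inf_mod :: "('f::padic_field^'n^'n) set \<Rightarrow> ('f^'n^'n) set \<Rightarrow>
    ('f^'n^'n \<Rightarrow> complex) \<Rightarrow> ('f^'n^'n \<Rightarrow> complex) set" where
  "Cc_inf_mod H Z \<omega> = {h. locally_constant_on H h \<and>
     (\<exists>K\<subseteq>H. compact K \<and> (\<forall>m\<in>H. h m \<noteq> 0 \<longrightarrow> (\<exists>z\<in>Z. \<exists>k\<in>K. m = z ** k))) \<and>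
     (\<forall>z\<in>Z. \<forall>m\<in>H. h (z ** m) = inverse (\<omega> z) * h m)}"

definition coset_rep :: "'a set \<Rightarrow> 'a" where
  "coset_rep C = (SOME m. m \<in> C)"

text \<open>
  The quotient measure of \<open>\<mu>\<close> by \<open>\<nu>\<close> on \<open>H / Z\<close>: a measure on the Borel sets of the quotient topology,
  characterized by the integration formula over the fibres.
\<close>

definition quotient_measure :: "('f::padic_field^'n^'n) set \<Rightarrow> ('f^'n^'n) set \<Rightarrow>
    ('f^'n^'n) measure \<Rightarrow> ('f^'n^'n) measure \<Rightarrow> ('f^'n^'n) set measure \<Rightarrow> bool" where
  "quotient_measure H Z \<mu> \<nu> \<kappa> \<longleftrightarrow>
     space \<kappa> = carrier (mat_group H Mod Z) \<and>
     sets \<kappa> = sigma_sets (carrier (mat_group H Mod Z))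
                {S. S \<subseteq> carrier (mat_group H Mod Z) \<and> openin (top_of_set H) (\<Union>S)} \<and>
     (\<forall>f\<in>Cc_inf H.
        integrable \<kappa> (\<lambda>C. \<integral>z. f (z ** coset_rep C) \<partial>\<nu>) \<and>
        (\<integral>m. f m \<partial>\<mu>) = (\<integral>C. (\<integral>z. f (z ** coset_rep C) \<partial>\<nu>) \<partial>\<kappa>))"


section \<open>Smooth representations\<close>

text \<open>
  Irreducible smooth representations of a second countable, locally profinite group have countable
  dimension.  So each of them is equivalent to one whose space is a subspace of the space of
  finitely supported sequences of complex numbers, and only such spaces are considered.
\<close>

type_synonym cvec = "nat \<Rightarrow>\<^sub>0 complex"

definition cscale :: "complex \<Rightarrow> cvec \<Rightarrow> cvec" where
  "cscale c v = Poly_Mapping.map ((*) c) v"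

lemma lookup_cscale: "Poly_Mapping.lookup (cscale c v) i = c * Poly_Mapping.lookup v i"
  by (simp add: cscale_def Poly_Mapping.map.rep_eq when_def)

interpretation cvs: vector_space cscale
  by unfold_locales
    (auto intro!: poly_mapping_eqI simp: lookup_cscale lookup_add algebra_simps)

record 'g rep =
  rep_space :: "cvec set"
  rep_act :: "'g \<Rightarrow> cvec \<Rightarrow> cvec"

definition clinear_on :: "cvec set \<Rightarrow> (cvec \<Rightarrow> cvec) \<Rightarrow> bool" where
  "clinear_on V T \<longleftrightarrow>
     (\<forall>v\<in>V. \<forall>w\<in>V. T (v + w) = T v + T w) \<and> (\<forall>c. \<forall>v\<in>V. T (cscale c v) = cscale c (T v))"

definition smooth_rep :: "('f::padic_field^'n^'n) set \<Rightarrow> ('f^'n^'n) rep \<Rightarrow> bool" where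
  "smooth_rep H \<pi> \<longleftrightarrow>
     cvs.subspace (rep_space \<pi>) \<and>
     (\<forall>m\<in>H. clinear_on (rep_space \<pi>) (rep_act \<pi> m) \<and>
        (\<forall>v\<in>rep_space \<pi>. rep_act \<pi> m v \<in> rep_space \<pi>)) \<and>
     (\<forall>v\<in>rep_space \<pi>. rep_act \<pi> (mat 1) v = v) \<and>
     (\<forall>x\<in>H. \<forall>y\<in>H. \<forall>v\<in>rep_space \<pi>. rep_act \<pi> (x ** y) v = rep_act \<pi> x (rep_act \<pi> y v)) \<and>
     (\<forall>v\<in>rep_space \<pi>. openin (top_of_set H) {m \<in> H. rep_act \<pi> m v = v})"

definition irreducible_rep :: "('f::padic_field^'n^'n) set \<Rightarrow> ('f^'n^'n) rep \<Rightarrow> bool" where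
  "irreducible_rep H \<pi> \<longleftrightarrow>
     smooth_rep H \<pi> \<and> rep_space \<pi> \<noteq> {0} \<and>
     (\<forall>W. cvs.subspace W \<and> W \<subseteq> rep_space \<pi> \<and> (\<forall>m\<in>H. \<forall>w\<in>W. rep_act \<pi> m w \<in> W) \<longrightarrow>
        W = {0} \<or> W = rep_space \<pi>)"

definition equivalent :: "'g set \<Rightarrow> 'g rep \<Rightarrow> 'g rep \<Rightarrow> bool" where
  "equivalent H \<pi> \<rho> \<longleftrightarrow>
     (\<exists>T. clinear_on (rep_space \<pi>) T \<and> bij_betw T (rep_space \<pi>) (rep_space \<rho>) \<and>
        (\<forall>m\<in>H. \<forall>v\<in>rep_space \<pi>. T (rep_act \<pi> m v) = rep_act \<rho> m (T v)))"

definition unitary_character ::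
    "('f::padic_field^'n^'n) set \<Rightarrow> ('f^'n^'n \<Rightarrow> complex) \<Rightarrow> bool" where
  "unitary_character Z \<omega> \<longleftrightarrow>
     continuous_on Z \<omega> \<and> (\<forall>z\<in>Z. cmod (\<omega> z) = 1) \<and> (\<forall>x\<in>Z. \<forall>y\<in>Z. \<omega> (x ** y) = \<omega> x * \<omega> y)"

definition has_central_character :: "'g set \<Rightarrow> ('g \<Rightarrow> complex) \<Rightarrow> 'g rep \<Rightarrow> bool" where
  "has_central_character Z \<omega> \<pi> \<longleftrightarrow>
     (\<forall>z\<in>Z. \<forall>v\<in>rep_space \<pi>. rep_act \<pi> z v = cscale (\<omega> z) v)"

definition unitary_rep :: "'g set \<Rightarrow> 'g rep \<Rightarrow> bool" where
  "unitary_rep H \<pi> \<longleftrightarrow>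
     (\<exists>B :: cvec \<Rightarrow> cvec \<Rightarrow> complex. \<forall>u\<in>rep_space \<pi>. \<forall>v\<in>rep_space \<pi>.
        (\<forall>w\<in>rep_space \<pi>. B (u + v) w = B u w + B v w) \<and>
        (\<forall>c. B (cscale c u) v = c * B u v) \<and>
        B v u = cnj (B u v) \<and>
        (u \<noteq> 0 \<longrightarrow> Re (B u u) > 0) \<and>
        (\<forall>m\<in>H. B (rep_act \<pi> m u) (rep_act \<pi> m v) = B u v))"

definition smooth_dual :: "('f::padic_field^'n^'n) set \<Rightarrow> ('f^'n^'n) rep \<Rightarrow> (cvec \<Rightarrow> complex) set" where
  "smooth_dual H \<pi> = {l.
     (\<forall>v\<in>rep_space \<pi>. \<forall>w\<in>rep_space \<pi>. l (v + w) = l v + l w) \<and>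
     (\<forall>c. \<forall>v\<in>rep_space \<pi>. l (cscale c v) = c * l v) \<and>
     openin (top_of_set H) {m \<in> H. \<forall>v\<in>rep_space \<pi>. l (rep_act \<pi> m v) = l v}}"

definition matrix_coefficients ::
    "('f::padic_field^'n^'n) set \<Rightarrow> ('f^'n^'n) rep \<Rightarrow> ('f^'n^'n \<Rightarrow> complex) set" where
  "matrix_coefficients H \<pi> = {\<lambda>m. l (rep_act \<pi> m v) |l v. l \<in> smooth_dual H \<pi> \<and> v \<in> rep_space \<pi>}"

text \<open>
  For representations with unitary central character the absolute value of a matrix coefficient is
  a function on \<open>H / Z\<close>; \<open>\<kappa>\<close> is the measure on that quotient.
\<close>

definition Lp_mod_center :: "'g set measure \<Rightarrow> real \<Rightarrow> ('g \<Rightarrow> complex) \<Rightarrow> bool" where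
  "Lp_mod_center \<kappa> p c \<longleftrightarrow> (\<integral>\<^sup>+ C. ennreal (cmod (c (coset_rep C)) powr p) \<partial>\<kappa>) < \<infinity>"

definition disc_reps :: "('f::padic_field^'n^'n) set \<Rightarrow> ('f^'n^'n) set \<Rightarrow>
    ('f^'n^'n) set measure \<Rightarrow> ('f^'n^'n \<Rightarrow> complex) \<Rightarrow> ('f^'n^'n) rep set" where
  "disc_reps H Z \<kappa> \<omega> = {\<pi>. irreducible_rep H \<pi> \<and> unitary_rep H \<pi> \<and> has_central_character Z \<omega> \<pi> \<and>
     (\<forall>c\<in>matrix_coefficients H \<pi>. Lp_mod_center \<kappa> 2 c)}"

text \<open>
  Temperedness: unitary central character, and matrix coefficients in \<open>L\<^sup>2\<^sup>+\<^sup>\<epsilon>\<close> modulo the centre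
  for every positive \<open>\<epsilon>\<close>.
\<close>

definition temp_reps :: "('f::padic_field^'n^'n) set \<Rightarrow> ('f^'n^'n) set \<Rightarrow>
    ('f^'n^'n) set measure \<Rightarrow> ('f^'n^'n) rep set" where
  "temp_reps H Z \<kappa> = {\<pi>. irreducible_rep H \<pi> \<and>
     (\<exists>\<omega>. unitary_character Z \<omega> \<and> has_central_character Z \<omega> \<pi>) \<and>
     (\<forall>c\<in>matrix_coefficients H \<pi>. \<forall>\<epsilon>>0. Lp_mod_center \<kappa> (2 + \<epsilon>) c)}"

definition temp_reps_char :: "('f::padic_field^'n^'n) set \<Rightarrow> ('f^'n^'n) set \<Rightarrow>
    ('f^'n^'n) set measure \<Rightarrow> ('f^'n^'n \<Rightarrow> complex) \<Rightarrow> ('f^'n^'n) rep set" where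
  "temp_reps_char H Z \<kappa> \<omega> = {\<pi> \<in> temp_reps H Z \<kappa>. has_central_character Z \<omega> \<pi>}"


section \<open>Traces\<close>

text \<open>
  The vectors \<open>h(m)\<pi>(m)v\<close> depend on \<open>m\<close> in a locally constant, compactly supported way.
  So their integral is a finite sum over the nonzero values.
\<close>

definition simple_integral :: "'x measure \<Rightarrow> ('x \<Rightarrow> cvec) \<Rightarrow> cvec" where
  "simple_integral \<mu> f =
     (\<Sum>w\<in>f ` space \<mu> - {0}. cscale (of_real (measure \<mu> {x \<in> space \<mu>. f x = w})) w)"

text \<open>
  The trace on \<open>V\<close> of a finite rank operator, computed on its image.  The operators below have finite
  rank since irreducible smooth representations are admissible.
\<close>

definition finite_rank_trace :: "cvec set \<Rightarrow> (cvec \<Rightarrow> cvec) \<Rightarrow> complex" where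
  "finite_rank_trace V T =
     (let B = (SOME B. cvs.independent B \<and> cvs.span B = T ` V)
      in \<Sum>b\<in>B. cvs.representation B (T b) b)"

definition trace_rep ::
    "('f::padic_field^'n^'n) measure \<Rightarrow> ('f^'n^'n) rep \<Rightarrow> ('f^'n^'n \<Rightarrow> complex) \<Rightarrow> complex" where
  "trace_rep \<mu> \<pi> h =
     finite_rank_trace (rep_space \<pi>) (\<lambda>v. simple_integral \<mu> (\<lambda>m. cscale (h m) (rep_act \<pi> m v)))"

definition trace_rep_mod ::
    "('f::padic_field^'n^'n) set measure \<Rightarrow> ('f^'n^'n) rep \<Rightarrow> ('f^'n^'n \<Rightarrow> complex) \<Rightarrow> complex" where
  "trace_rep_mod \<kappa> \<pi> h =
     finite_rank_trace (rep_space \<pi>)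
       (\<lambda>v. simple_integral \<kappa> (\<lambda>C. cscale (h (coset_rep C)) (rep_act \<pi> (coset_rep C) v)))"


section \<open>Unramified twists and pseudo-coefficients\<close>

text \<open>\<open>H1\<close> stands for \<open>F_points1 M\<close>; elements of \<open>Hom(H/H1, C\<^sup>\<times>)\<close> are viewed as characters of \<open>H\<close>.\<close>

definition unramified_chars ::
    "('f::padic_field^'n^'n) set \<Rightarrow> ('f^'n^'n) set \<Rightarrow> ('f^'n^'n \<Rightarrow> complex) set" where
  "unramified_chars H H1 = {\<psi>. (\<forall>m\<in>H. \<psi> m \<noteq> 0) \<and> (\<forall>m\<in>H1. \<psi> m = 1) \<and>
     (\<forall>x\<in>H. \<forall>y\<in>H. \<psi> (x ** y) = \<psi> x * \<psi> y)}"

definition twist :: "'g rep \<Rightarrow> ('g \<Rightarrow> complex) \<Rightarrow> 'g rep" where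
  "twist \<sigma> \<psi> = \<sigma>\<lparr>rep_act := \<lambda>m v. cscale (\<psi> m) (rep_act \<sigma> m v)\<rparr>"

definition twist_orbit :: "('f::padic_field^'n^'n) set \<Rightarrow> ('f^'n^'n) set \<Rightarrow>
    ('f^'n^'n) rep \<Rightarrow> ('f^'n^'n) rep set" where
  "twist_orbit H H1 \<sigma> = {\<pi>. smooth_rep H \<pi> \<and> (\<exists>\<psi>\<in>unramified_chars H H1. equivalent H \<pi> (twist \<sigma> \<psi>))}"

text \<open>
  A function on the orbit, i.e. one depending only on equivalence classes, such that its pull-back
  to the unramified characters is a Laurent polynomial in the coordinates given by an isomorphism
  of \<open>H/H1\<close> with the free abelian group of rank d.  The elements \<open>b i\<close> lift the standard basis, so
  \<open>\<psi> (b i)\<close> is the i-th coordinate of \<open>\<psi>\<close>.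
\<close>

definition regular_on_orbit :: "('f::padic_field^'n^'n) set \<Rightarrow> ('f^'n^'n) set \<Rightarrow> nat \<Rightarrow>
    ('f^'n^'n) rep \<Rightarrow> (('f^'n^'n) rep \<Rightarrow> complex) \<Rightarrow> bool" where
  "regular_on_orbit H H1 d \<sigma> \<xi> \<longleftrightarrow>
     (\<forall>\<pi>\<in>twist_orbit H H1 \<sigma>. \<forall>\<rho>\<in>twist_orbit H H1 \<sigma>. equivalent H \<pi> \<rho> \<longrightarrow> \<xi> \<pi> = \<xi> \<rho>) \<and>
     (\<exists>\<theta> b L. \<theta> \<in> iso (mat_group H Mod H1) (free_Abelian_group {..<d}) \<and>
        (\<forall>i<d. b i \<in> H \<and> \<theta> (H1 #>\<^bsub>mat_group H\<^esub> b i) = Poly_Mapping.single i 1) \<and>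
        L \<in> laurent_funs UNIV d \<and>
        (\<forall>\<psi>\<in>unramified_chars H H1. \<xi> (twist \<sigma> \<psi>) = L (\<lambda>i. \<psi> (b i))))"

definition generalized_pseudo_coefficient :: "('f::padic_field^'n^'n) set \<Rightarrow> ('f^'n^'n) set \<Rightarrow>
    ('f^'n^'n) set \<Rightarrow> ('f^'n^'n) measure \<Rightarrow> ('f^'n^'n) set measure \<Rightarrow>
    ('f^'n^'n) rep \<Rightarrow> (('f^'n^'n) rep \<Rightarrow> complex) \<Rightarrow> ('f^'n^'n \<Rightarrow> complex) \<Rightarrow> bool" where
  "generalized_pseudo_coefficient H H1 Z \<mu> \<kappa> \<sigma> \<xi> \<phi> \<longleftrightarrow>
     \<phi> \<in> Cc_inf H \<and>
     (\<forall>\<pi>\<in>temp_reps H Z \<kappa>. trace_rep \<mu> \<pi> \<phi> = (if \<pi> \<in> twist_orbit H H1 \<sigma> then \<xi> \<pi> else 0))"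

definition pseudo_coefficient :: "('f::padic_field^'n^'n) set \<Rightarrow> ('f^'n^'n) set \<Rightarrow>
    ('f^'n^'n) set measure \<Rightarrow> ('f^'n^'n \<Rightarrow> complex) \<Rightarrow>
    ('f^'n^'n) rep \<Rightarrow> ('f^'n^'n \<Rightarrow> complex) \<Rightarrow> bool" where
  "pseudo_coefficient H Z \<kappa> \<omega> \<delta> \<phi> \<longleftrightarrow>
     \<phi> \<in> Cc_inf_mod H Z \<omega> \<and>
     (\<forall>\<pi>\<in>temp_reps_char H Z \<kappa> \<omega>. trace_rep_mod \<kappa> \<pi> \<phi> = (if equivalent H \<pi> \<delta> then 1 else 0))"

end

theory Submission
  imports Defs
begin

unbundle no fps_syntax

text \<open>
  Write \<open>\<Phi>\<close> for the projection of \<open>\<phi>\<close>.  There are two independent reasons at work.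

  The first is Fubini for \<open>H \<rightarrow> H / Z\<close>.  If \<open>\<pi>\<close> has central character \<open>\<omega>\<close>, then the integral of
  \<open>\<phi>(zm)\<pi>(zm)v\<close> over \<open>z\<close> in \<open>Z\<close> is \<open>\<Phi>(m)\<pi>(m)v\<close>, so \<open>\<phi>\<close> on \<open>H\<close> and \<open>\<Phi>\<close> on \<open>H / Z\<close> act on \<open>\<pi>\<close> by the same
  operator and have the same trace (\<open>trace_central_projection\<close>).  The quotient measure is known only
  through its integration formula on complex valued test functions; this suffices because every
  coordinate of \<open>m \<mapsto> \<phi>(m)\<pi>(m)v\<close> is such a function.  That \<open>\<Phi>\<close> is again locally constant rests on the
  uniform local constancy of \<open>\<phi>\<close> (\<open>Cc_inf_uniformly_locally_constant\<close>).

  Hence the trace of \<open>\<pi>\<close> at \<open>\<Phi>\<close> is \<open>\<xi>(\<pi>)\<close> on the orbit of \<open>\<sigma>\<close> and \<open>0\<close> elsewhere.  It is \<open>1\<close> at \<open>\<sigma>\<close>, and what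
  remains is that a tempered \<open>\<pi>\<close> in the orbit with central character \<open>\<omega>\<close> is a discrete series
  representation, so that the hypothesis on \<open>\<xi>\<close> applies to it.  Let \<open>\<pi> \<simeq> \<sigma> \<otimes> \<psi>\<close>.  Comparing central
  characters, \<open>\<psi>\<close> is trivial on \<open>Z\<close>.  If \<open>|\<psi>| = 1\<close>, then the invariant hermitian form and the square
  integrability of matrix coefficients pass from \<open>\<sigma>\<close> to \<open>\<pi>\<close> (\<open>disc_reps_unitary_twist\<close>).

  The second reason gives \<open>|\<psi>| = 1\<close>: the image of \<open>Z\<close> in \<open>H / H1\<close> has full rank \<open>d\<close>, so some power of
  every \<open>h\<close> in \<open>H\<close> lies in \<open>Z H1\<close> and \<open>\<psi>(h)\<close> is a root of unity (\<open>unramified_char_unitary\<close>).  For the rank,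
  choose \<open>q\<close> in \<open>F\<close> with \<open>0 < |q| < 1\<close> and consider the points of \<open>A\<close> with coordinates \<open>q\<close> to the power \<open>k l\<close>,
  for integer vectors \<open>k\<close>.  Such a point is the value at \<open>q\<close> of a cocharacter \<open>L\<close> of \<open>A\<close>.  The weight
  spaces of \<open>L\<close> are stable under \<open>M\<close>, since \<open>A\<close> is central, and are defined over \<open>F\<close>; the determinant
  of \<open>M\<close> on one of them is a rational character whose value at \<open>L(q)\<close> is a power of \<open>q\<close>, with nonzero
  exponent as soon as the weight is nonzero.  If \<open>L(q)\<close> is in \<open>H1\<close>, then all weights vanish, \<open>L\<close> is
  trivial, and \<open>k = 0\<close> (\<open>bounded_cocharacter_trivial\<close>, \<open>split_torus_lattice\<close>).
\<close>

section \<open>Topology of the field\<close>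

lemma absF_0 [simp]: "absF (0::'f::padic_field) = 0"
  using dist_absF[of "0::'f" 0] by simp

lemma absF_eq_0_iff [simp]: "absF (x::'f::padic_field) = 0 \<longleftrightarrow> x = 0"
  using dist_absF[of x 0] by (metis diff_zero dist_eq_0_iff)

lemma absF_nonneg [simp]: "absF (x::'f::padic_field) \<ge> 0"
  using dist_absF[of x 0] by (metis diff_zero zero_le_dist)

lemma absF_1 [simp]: "absF (1::'f::padic_field) = 1"
  using absF_mult[of "1::'f" 1] by simp

lemma absF_minus [simp]: "absF (- x) = absF (x::'f::padic_field)"
  using dist_absF[of x 0] dist_absF[of 0 x] by (simp add: dist_commute)

lemma absF_power: "absF (x ^ k) = absF (x::'f::padic_field) ^ k"
  by (induction k) (auto simp: absF_mult)

lemma absF_sum_less: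
  fixes f :: "'i \<Rightarrow> 'f::padic_field"
  assumes "e > 0" "\<And>i. i \<in> I \<Longrightarrow> absF (f i) < e"
  shows "absF (\<Sum>i\<in>I. f i) < e"
  using assms(2)
proof (induction I rule: infinite_finite_induct)
  case (insert i I)
  then show ?case
    using absF_ultrametric[of "f i" "sum f I"] by fastforce
qed (use \<open>e > 0\<close> in auto)

instance padic_field \<subseteq> topological_ab_group_add
proof
  fix a b :: 'a
  show "LIM x (nhds a \<times>\<^sub>F nhds b). fst x + snd x :> nhds (a + b)"
    unfolding tendsto_iff
  proof (intro allI impI)
    fix e :: real assume "e > 0"
    have "\<forall>\<^sub>F x in nhds a. dist x a < e" "\<forall>\<^sub>F x in nhds b. dist x b < e"
      using \<open>e > 0\<close> by (auto simp: eventually_nhds_metric)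
    then have "\<forall>\<^sub>F x in nhds a \<times>\<^sub>F nhds b. dist (fst x) a < e \<and> dist (snd x) b < e"
      unfolding eventually_prod_filter by fastforce
    then show "\<forall>\<^sub>F x in nhds a \<times>\<^sub>F nhds b. dist (fst x + snd x) (a + b) < e"
    proof eventually_elim
      case (elim x)
      then show ?case
        using absF_ultrametric[of "fst x - a" "snd x - b"]
        by (auto simp: dist_absF algebra_simps)
    qed
  qed
next
  fix a :: 'a
  show "(uminus \<longlongrightarrow> - a) (nhds a)"
    unfolding tendsto_iff
  proof (intro allI impI)
    fix e :: real assume "e > 0"
    then have "\<forall>\<^sub>F x in nhds a. dist x a < e"
      by (auto simp: eventually_nhds_metric)
    then show "\<forall>\<^sub>F x in nhds a. dist (- x) (- a) < e"
      by eventually_elim (metis absF_minus dist_absF minus_diff_minus)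
  qed
qed

lemma continuous_on_cmult_padic:
  fixes f :: "'x::topological_space \<Rightarrow> 'f::padic_field"
  assumes "continuous_on S f"
  shows "continuous_on S (\<lambda>x. c * f x)"
proof -
  have "continuous_on UNIV ((*) c)"
  proof (cases "c = 0")
    case False
    then have c: "absF c > 0" by (simp add: less_le)
    show ?thesis unfolding continuous_on_iff
    proof (intro ballI allI impI)
      fix a :: 'f and e :: real assume "e > 0"
      have "dist (c * x) (c * a) < e" if "dist x a < e / absF c" for x
      proof -
        have "dist (c * x) (c * a) = dist x a * absF c"
          by (metis absF_mult dist_absF mult.commute right_diff_distrib)
        then show ?thesis using that c by (simp add: pos_less_divide_eq)
      qed
      moreover have "e / absF c > 0" using c \<open>e > 0\<close> by simp
      ultimately show "\<exists>d>0. \<forall>x\<in>UNIV. dist x a < d \<longrightarrow> dist (c * x) (c * a) < e" by blast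
    qed
  qed simp
  then show ?thesis
    using continuous_on_compose2[OF _ assms, of UNIV "(*) c"] by simp
qed

lemma continuous_on_matrix_mult_left:
  "continuous_on S (\<lambda>x :: 'f::padic_field^'n^'m. a ** x)"
  unfolding matrix_matrix_mult_def
  by (intro continuous_on_vec_lambda continuous_on_sum continuous_on_cmult_padic continuous_intros)

lemma continuous_on_matrix_mult_right:
  "continuous_on S (\<lambda>x :: 'f::padic_field^'n^'m. x ** a)"
  unfolding matrix_matrix_mult_def
  by (intro continuous_on_vec_lambda continuous_on_sum, subst mult.commute)
     (intro continuous_on_cmult_padic continuous_intros)

section \<open>Locally constant functions\<close>

lemma locally_constant_on_iff:
  "locally_constant_on H f \<longleftrightarrow> (\<forall>w. openin (top_of_set H) {x \<in> H. f x = w})"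
proof
  assume L: "locally_constant_on H f"
  show "\<forall>w. openin (top_of_set H) {x \<in> H. f x = w}"
  proof
    fix w
    show "openin (top_of_set H) {x \<in> H. f x = w}"
    proof (subst openin_subopen, intro ballI)
      fix x assume "x \<in> {x \<in> H. f x = w}"
      then obtain U where "openin (top_of_set H) U" "x \<in> U" "\<forall>y\<in>U. f y = f x" "f x = w"
        using L unfolding locally_constant_on_def by blast
      then show "\<exists>T. openin (top_of_set H) T \<and> x \<in> T \<and> T \<subseteq> {x \<in> H. f x = w}"
        using openin_subset by (intro exI[of _ U]) fastforce
    qed
  qed
next
  assume R: "\<forall>w. openin (top_of_set H) {x \<in> H. f x = w}"
  show "locally_constant_on H f"
    unfolding locally_constant_on_def
  proof
    fix x assume "x \<in> H"
    then show "\<exists>U. openin (top_of_set H) U \<and> x \<in> U \<and> (\<forall>y\<in>U. f y = f x)"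
      using R by (intro exI[of _ "{y \<in> H. f y = f x}"]) auto
  qed
qed

lemma locally_constant_on_combine:
  assumes "locally_constant_on H f" "locally_constant_on H g"
  shows "locally_constant_on H (\<lambda>x. F (f x) (g x))"
  unfolding locally_constant_on_def
proof
  fix x assume "x \<in> H"
  obtain U where U: "openin (top_of_set H) U" "x \<in> U" "\<forall>y\<in>U. f y = f x"
    using assms(1) \<open>x \<in> H\<close> unfolding locally_constant_on_def by blast
  obtain V where V: "openin (top_of_set H) V" "x \<in> V" "\<forall>y\<in>V. g y = g x"
    using assms(2) \<open>x \<in> H\<close> unfolding locally_constant_on_def by blast
  have "\<forall>y\<in>U \<inter> V. F (f y) (g y) = F (f x) (g x)"
    using U(3) V(3) by (metis IntE)
  then show "\<exists>U. openin (top_of_set H) U \<and> x \<in> U \<and> (\<forall>y\<in>U. F (f y) (g y) = F (f x) (g x))"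
    using U(1,2) V(1,2) by (intro exI[of _ "U \<inter> V"] conjI openin_Int) blast+
qed

lemma locally_constant_on_compose_fun:
  assumes "locally_constant_on H f"
  shows "locally_constant_on H (\<lambda>x. F (f x))"
  using locally_constant_on_combine[OF assms assms, of "\<lambda>a _. F a"] .

lemma continuous_on_locally_constant:
  assumes "locally_constant_on H f"
  shows "continuous_on H f"
  unfolding continuous_on_open_invariant
proof (intro allI impI)
  fix B :: "'b set" assume "open B"
  have "openin (top_of_set H) (\<Union>w\<in>B. {x \<in> H. f x = w})"
    using assms unfolding locally_constant_on_iff by (intro openin_Union) blast
  then obtain A where "open A" "(\<Union>w\<in>B. {x \<in> H. f x = w}) = H \<inter> A"
    unfolding openin_open by blast
  moreover have "(\<Union>w\<in>B. {x \<in> H. f x = w}) = f -` B \<inter> H" by blast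
  ultimately show "\<exists>A. open A \<and> A \<inter> H = f -` B \<inter> H" by (metis inf_commute)
qed

lemma compact_openin_finite_subcover:
  assumes "compact K" "K \<subseteq> H" "\<And>x. x \<in> K \<Longrightarrow> openin (top_of_set H) (C x) \<and> x \<in> C x"
  obtains F where "finite F" "F \<subseteq> K" "K \<subseteq> (\<Union>x\<in>F. C x)"
proof -
  have "\<exists>T. open T \<and> C x = H \<inter> T" if "x \<in> K" for x
    using assms(3)[OF that] unfolding openin_open by blast
  then obtain T where T: "\<And>x. x \<in> K \<Longrightarrow> open (T x) \<and> C x = H \<inter> T x" by metis
  have "K \<subseteq> (\<Union>x\<in>K. T x)" using T assms(3) by blast
  then obtain F where F: "F \<subseteq> K" "finite F" "K \<subseteq> (\<Union>x\<in>F. T x)"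
    using compactE_image[OF assms(1), of K T] T by metis
  have "K \<subseteq> (\<Union>x\<in>F. C x)"
    using F T assms(2) by (smt (verit, best) IntI UN_E UN_I subset_eq)
  with F show ?thesis using that by blast
qed

lemma finite_image_locally_constant:
  assumes "locally_constant_on H f" "compact K" "K \<subseteq> H"
  shows "finite (f ` K)"
proof -
  obtain F where "finite F" "F \<subseteq> K" "K \<subseteq> (\<Union>x\<in>F. {y \<in> H. f y = f x})"
    using compact_openin_finite_subcover[OF assms(2,3), of "\<lambda>x. {y \<in> H. f y = f x}"] assms(1,3)
    unfolding locally_constant_on_iff by blast
  then have "f ` K \<subseteq> f ` F" by blast
  then show ?thesis using \<open>finite F\<close> by (meson finite_imageI finite_subset)
qed

section \<open>Matrix groups and their congruence subgroups\<close>

lemma matrix_add_rdistrib: "(A + B) ** C = A ** C + B ** (C :: 'a::semiring_1^'n^'m)"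
  by (simp add: matrix_matrix_mult_def vec_eq_iff sum.distrib distrib_right)

lemma matrix_inv_mult:
  assumes "invertible (x :: 'a::semiring_1^'n^'n)"
  shows "x ** matrix_inv x = mat 1" "matrix_inv x ** x = mat 1"
  using someI_ex[OF assms[unfolded invertible_def]] unfolding matrix_inv_def by auto

locale matrix_group =
  fixes H :: "('f::field^'n^'n) set"
  assumes one_mem: "mat 1 \<in> H"
    and mult_mem: "\<And>x y. x \<in> H \<Longrightarrow> y \<in> H \<Longrightarrow> x ** y \<in> H"
    and inv_mem: "\<And>x. x \<in> H \<Longrightarrow> invertible x \<and> matrix_inv x \<in> H"
begin

lemma mult_inv: "x \<in> H \<Longrightarrow> x ** matrix_inv x = mat 1" "x \<in> H \<Longrightarrow> matrix_inv x ** x = mat 1"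
  using inv_mem matrix_inv_mult by blast+

lemma mult_inv_cancel [simp]:
  "x \<in> H \<Longrightarrow> x ** (matrix_inv x ** y) = y" "x \<in> H \<Longrightarrow> matrix_inv x ** (x ** y) = y"
  by (simp_all add: matrix_mul_assoc mult_inv)

lemma group_mat_group: "group (mat_group H)"
  by (rule groupI)
     (auto simp: mat_group_def one_mem mult_mem matrix_mul_assoc intro!: bexI[of _ "matrix_inv _"] mult_inv inv_mem[THEN conjunct2])

end

locale padic_matrix_group = matrix_group H for H :: "('f::padic_field^'n^'n) set"
begin

lemma openin_translate_left:
  assumes "x \<in> H" "openin (top_of_set H) U"
  shows "openin (top_of_set H) {y \<in> H. x ** y \<in> U}"
proof -
  have "openin (top_of_set H) (H \<inter> (**) x -` U)"
    using assms mult_mem by (intro continuous_openin_preimage[OF continuous_on_matrix_mult_left]) auto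
  moreover have "H \<inter> (**) x -` U = {y \<in> H. x ** y \<in> U}" by auto
  ultimately show ?thesis by simp
qed

lemma locally_constant_onI_right:
  assumes "\<And>x. x \<in> H \<Longrightarrow> \<exists>U. openin (top_of_set H) U \<and> mat 1 \<in> U \<and> (\<forall>u\<in>U. f (x ** u) = f x)"
  shows "locally_constant_on H f"
  unfolding locally_constant_on_def
proof
  fix x assume x: "x \<in> H"
  then obtain U where U: "openin (top_of_set H) U" "mat 1 \<in> U" "\<forall>u\<in>U. f (x ** u) = f x"
    using assms by blast
  show "\<exists>V. openin (top_of_set H) V \<and> x \<in> V \<and> (\<forall>y\<in>V. f y = f x)"
  proof (intro exI conjI ballI)
    show "openin (top_of_set H) {y \<in> H. matrix_inv x ** y \<in> U}"
      using openin_translate_left U x inv_mem by blast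
    show "x \<in> {y \<in> H. matrix_inv x ** y \<in> U}"
      using U x mult_inv by auto
    fix y assume "y \<in> {y \<in> H. matrix_inv x ** y \<in> U}"
    then have "f (x ** (matrix_inv x ** y)) = f x" using U by blast
    then show "f y = f x" using x by simp
  qed
qed

text \<open>
  For \<open>0 < e \<le> 1\<close> these are groups, because of the ultrametric inequality.  Their cosets partition \<open>H\<close>,
  which makes uniform local constancy on a compact set extend to all of \<open>H\<close>.
\<close>

definition cong_subgroup :: "real \<Rightarrow> ('f^'n^'n) set" where
  "cong_subgroup e = {u \<in> H. \<forall>i j. absF ((u - mat 1) $ i $ j) < e}"

lemma openin_cong_subgroup: "openin (top_of_set H) (cong_subgroup e)"
proof -
  have "open {u :: 'f^'n^'n. dist (u $ i $ j) (mat 1 $ i $ j) < e}" for i j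
    by (intro open_Collect_less continuous_intros)
  then have "open (\<Inter>i. \<Inter>j. {u :: 'f^'n^'n. dist (u $ i $ j) (mat 1 $ i $ j) < e})"
    by (intro open_INT) auto
  moreover have "cong_subgroup e = H \<inter> (\<Inter>i. \<Inter>j. {u. dist (u $ i $ j) (mat 1 $ i $ j) < e})"
    by (auto simp: cong_subgroup_def dist_absF)
  ultimately show ?thesis by (auto simp: openin_open)
qed

lemma one_cong_subgroup: "e > 0 \<Longrightarrow> mat 1 \<in> cong_subgroup e"
  by (auto simp: cong_subgroup_def one_mem)

lemma cong_subgroup_mono: "e \<le> e' \<Longrightarrow> cong_subgroup e \<subseteq> cong_subgroup e'"
  unfolding cong_subgroup_def by (auto intro: less_le_trans)

lemma mult_cong_subgroup:
  assumes "0 < e" "e \<le> 1" "u \<in> cong_subgroup e" "v \<in> cong_subgroup e"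
  shows "u ** v \<in> cong_subgroup e"
proof -
  have "absF ((u ** v - mat 1) $ i $ j) < e" for i j
  proof -
    define D where "D = u - mat 1"
    define Y where "Y = v - mat 1"
    have D: "absF (D $ i $ j) < e" and Y: "absF (Y $ i $ j) < e" for i j
      using assms by (auto simp: D_def Y_def cong_subgroup_def)
    have uv: "u = D + mat 1" "v = Y + mat 1" by (auto simp: D_def Y_def)
    have eq: "u ** v - mat 1 = D ** Y + (D + Y)"
      unfolding uv by (simp add: matrix_add_ldistrib matrix_add_rdistrib)
    have "absF ((D ** Y) $ i $ j) < e"
      unfolding matrix_matrix_mult_def vec_lambda_beta
    proof (rule absF_sum_less[OF \<open>e > 0\<close>])
      fix k
      have "absF (D $ i $ k) * absF (Y $ k $ j) \<le> absF (D $ i $ k) * 1"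
        using Y[of k j] assms(2) by (intro mult_left_mono) auto
      then show "absF (D $ i $ k * Y $ k $ j) < e"
        using D[of i k] by (simp add: absF_mult)
    qed
    moreover have "absF ((D + Y) $ i $ j) < e"
      using D[of i j] Y[of i j] absF_ultrametric[of "D $ i $ j" "Y $ i $ j"] by auto
    ultimately show ?thesis
      using absF_ultrametric[of "(D ** Y) $ i $ j" "(D + Y) $ i $ j"] unfolding eq by auto
  qed
  then show ?thesis
    using assms mult_mem by (auto simp: cong_subgroup_def)
qed

text \<open>
  With \<open>V\<close> the inverse of \<open>u = 1 + D\<close>, the equation \<open>V = 1 - D V\<close> bounds the entries of \<open>V\<close>: were the largest
  absolute value \<open>c\<close> greater than \<open>1\<close>, an entry attaining it would have to come from \<open>D V\<close>, whose entries are
  smaller than \<open>c\<close>.  Once \<open>c \<le> 1\<close>, the entries of \<open>V - 1 = - D V\<close> are smaller than \<open>e\<close>.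
\<close>

lemma inv_cong_subgroup:
  assumes "0 < e" "e \<le> 1" "u \<in> cong_subgroup e"
  shows "matrix_inv u \<in> cong_subgroup e"
proof -
  define V where "V = matrix_inv u"
  define D where "D = u - mat 1"
  have u: "u \<in> H" using assms by (simp add: cong_subgroup_def)
  have D: "absF (D $ i $ j) < e" for i j
    using assms by (auto simp: D_def cong_subgroup_def)
  have "(mat 1 + D) ** V = mat 1"
    using mult_inv[OF u] by (simp add: D_def V_def)
  then have eq: "V - mat 1 = - (D ** V)"
    by (simp add: matrix_add_rdistrib algebra_simps)
  define c where "c = Max (range (\<lambda>(i, j). absF (V $ i $ j)))"
  have c: "absF (V $ i $ j) \<le> c" for i j
    unfolding c_def by (rule Max_ge) (auto intro!: image_eqI[of _ _ "(i, j)"])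
  have "c \<in> range (\<lambda>(i, j). absF (V $ i $ j))"
    unfolding c_def by (rule Max_in) auto
  then obtain i0 j0 where c0: "c = absF (V $ i0 $ j0)" by auto
  have DV: "absF ((D ** V) $ i $ j) < e * b" if "b > 0" "\<And>i j. absF (V $ i $ j) \<le> b" for i j b
    unfolding matrix_matrix_mult_def vec_lambda_beta
  proof (rule absF_sum_less)
    show "e * b > 0" using that assms by simp
    fix k
    have "absF (D $ i $ k) * absF (V $ k $ j) \<le> absF (D $ i $ k) * b"
      using that by (intro mult_left_mono) auto
    also have "\<dots> < e * b" using D[of i k] \<open>b > 0\<close> by simp
    finally show "absF (D $ i $ k * V $ k $ j) < e * b" by (simp add: absF_mult)
  qed
  have "c \<le> 1"
  proof (rule ccontr)
    assume "\<not> c \<le> 1"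
    then have "absF ((D ** V) $ i0 $ j0) < e * c"
      using DV[of c i0 j0] c by auto
    also have "\<dots> \<le> c" using assms \<open>\<not> c \<le> 1\<close> by simp
    finally have *: "absF ((D ** V) $ i0 $ j0) < c" .
    have "V = mat 1 + - (D ** V)" using eq by (simp add: algebra_simps)
    then have "V $ i0 $ j0 = mat 1 $ i0 $ j0 + - ((D ** V) $ i0 $ j0)"
      by (metis vector_add_component vector_uminus_component)
    then have "c \<le> max (absF (mat 1 $ i0 $ j0 :: 'f)) (absF ((D ** V) $ i0 $ j0))"
      using absF_ultrametric[of "mat 1 $ i0 $ j0" "- ((D ** V) $ i0 $ j0)"] c0 by simp
    moreover have "absF (mat 1 $ i0 $ j0 :: 'f) \<le> 1" by (simp add: mat_def)
    ultimately show False using * \<open>\<not> c \<le> 1\<close> by linarith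
  qed
  then have "absF (V $ i $ j) \<le> 1" for i j using c[of i j] by linarith
  then have "absF ((D ** V) $ i $ j) < e" for i j using DV[of 1 i j] by simp
  then have "absF ((V - mat 1) $ i $ j) < e" for i j
    unfolding eq by simp
  then show ?thesis
    using inv_mem[OF u] by (auto simp: cong_subgroup_def V_def)
qed

lemma cong_subgroup_basis:
  assumes "openin (top_of_set H) U" "mat 1 \<in> U"
  obtains e where "0 < e" "e \<le> 1" "cong_subgroup e \<subseteq> U"
proof -
  obtain T where T: "open T" "U = H \<inter> T" using assms by (auto simp: openin_open)
  then obtain r where r: "r > 0" "\<And>y. dist y (mat 1) < r \<Longrightarrow> y \<in> T"
    using assms by (auto simp: open_dist)
  define N where "N = real (CARD('n))"
  have "N > 0" by (simp add: N_def)
  define e where "e = min 1 (r / (2 * (N * N)))"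
  have "e > 0" "e \<le> 1" using r \<open>N > 0\<close> by (auto simp: e_def)
  moreover have "cong_subgroup e \<subseteq> U"
  proof
    fix u assume u: "u \<in> cong_subgroup e"
    then have d: "dist (u $ i $ j) (mat 1 $ i $ j) \<le> e" for i j
      by (auto simp: cong_subgroup_def dist_absF less_imp_le)
    have "dist (u $ i) (mat 1 $ i) \<le> N * e" for i
    proof -
      have "dist (u $ i) (mat 1 $ i) \<le> (\<Sum>j\<in>UNIV. dist (u $ i $ j) (mat 1 $ i $ j))"
        unfolding dist_vec_def by (rule L2_set_le_sum) simp
      also have "\<dots> \<le> (\<Sum>j\<in>(UNIV::'n set). e)" by (rule sum_mono) (rule d)
      finally show ?thesis by (simp add: N_def)
    qed
    then have "(\<Sum>i\<in>UNIV. dist (u $ i) (mat 1 $ i)) \<le> (\<Sum>i\<in>(UNIV::'n set). N * e)"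
      by (intro sum_mono)
    moreover have "dist u (mat 1) \<le> (\<Sum>i\<in>UNIV. dist (u $ i) (mat 1 $ i))"
      by (subst dist_vec_def) (rule L2_set_le_sum, simp)
    ultimately have "dist u (mat 1) \<le> (N * N) * e" by (simp add: N_def)
    also have "\<dots> \<le> (N * N) * (r / (2 * (N * N)))"
      using \<open>N > 0\<close> by (intro mult_left_mono) (auto simp: e_def)
    also have "\<dots> < r" using \<open>N > 0\<close> r by simp
    finally show "u \<in> U" using r T u by (auto simp: cong_subgroup_def)
  qed
  ultimately show ?thesis using that by blast
qed

text \<open>
  A finite number of cosets of congruence subgroups on which \<open>\<phi>\<close> is constant cover the support \<open>K\<close>; the smallest
  of these subgroups works for the points of \<open>K\<close>.  A point \<open>x\<close> outside \<open>K\<close> with \<open>x u\<close> in \<open>K\<close> is dealt with by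
  applying the first case to \<open>x u\<close> and the inverse of \<open>u\<close>, and here it matters that the neighbourhood is a group.
\<close>

lemma Cc_inf_uniformly_locally_constant:
  assumes "\<phi> \<in> Cc_inf H"
  obtains U where "openin (top_of_set H) U" "mat 1 \<in> U"
    "\<And>x u. x \<in> H \<Longrightarrow> u \<in> U \<Longrightarrow> \<phi> (x ** u) = \<phi> x"
proof -
  obtain K where L: "locally_constant_on H \<phi>" and K: "K \<subseteq> H" "compact K"
    "\<And>m. m \<in> H \<Longrightarrow> \<phi> m \<noteq> 0 \<Longrightarrow> m \<in> K"
    using assms unfolding Cc_inf_def by blast
  have "\<exists>e. 0 < e \<and> e \<le> 1 \<and> (\<forall>u\<in>cong_subgroup e. \<phi> (x ** u) = \<phi> x)" if "x \<in> K" for x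
  proof -
    have x: "x \<in> H" using that K by blast
    have "openin (top_of_set H) {u \<in> H. x ** u \<in> {y \<in> H. \<phi> y = \<phi> x}}"
      using L x by (intro openin_translate_left) (auto simp: locally_constant_on_iff)
    moreover have "mat 1 \<in> {u \<in> H. x ** u \<in> {y \<in> H. \<phi> y = \<phi> x}}"
      using x one_mem by auto
    ultimately obtain e where "0 < e" "e \<le> 1" "cong_subgroup e \<subseteq> {u \<in> H. x ** u \<in> {y \<in> H. \<phi> y = \<phi> x}}"
      using cong_subgroup_basis by blast
    then show ?thesis by blast
  qed
  then obtain e where e: "\<And>x. x \<in> K \<Longrightarrow> 0 < e x \<and> e x \<le> 1 \<and> (\<forall>u\<in>cong_subgroup (e x). \<phi> (x ** u) = \<phi> x)"
    by metis
  define C where "C x = {y \<in> H. matrix_inv x ** y \<in> cong_subgroup (e x)}" for x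
  have "openin (top_of_set H) (C x) \<and> x \<in> C x" if "x \<in> K" for x
    using that K(1) e[OF that] unfolding C_def
    by (auto intro!: openin_translate_left openin_cong_subgroup inv_mem[THEN conjunct2] one_cong_subgroup simp: mult_inv subset_iff)
  then obtain F where F: "finite F" "F \<subseteq> K" "K \<subseteq> (\<Union>x\<in>F. C x)"
    using compact_openin_finite_subcover[OF K(2,1), of C] by blast
  define \<epsilon> where "\<epsilon> = Min (insert 1 (e ` F))"
  have \<epsilon>: "0 < \<epsilon>" "\<epsilon> \<le> 1" "\<And>x. x \<in> F \<Longrightarrow> \<epsilon> \<le> e x"
    using F e by (auto simp: \<epsilon>_def)
  have on_K: "\<phi> (y ** u) = \<phi> y" if "y \<in> K" "u \<in> cong_subgroup \<epsilon>" for y u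
  proof -
    obtain x where x: "x \<in> F" "y \<in> C x" using F(3) \<open>y \<in> K\<close> by blast
    then have xK: "x \<in> K" "x \<in> H" using F K by auto
    define k where "k = matrix_inv x ** y"
    have k: "k \<in> cong_subgroup (e x)" "y = x ** k"
      using x xK by (auto simp: C_def k_def)
    have "u \<in> cong_subgroup (e x)" using that x \<epsilon> cong_subgroup_mono by blast
    then have "k ** u \<in> cong_subgroup (e x)" using e[OF xK(1)] k mult_cong_subgroup by blast
    then have "\<phi> (x ** (k ** u)) = \<phi> (x ** k)" using e[OF xK(1)] k by auto
    then show ?thesis using k by (simp add: matrix_mul_assoc)
  qed
  have "\<phi> (x ** u) = \<phi> x" if x: "x \<in> H" and u: "u \<in> cong_subgroup \<epsilon>" for x u
  proof (cases "x \<in> K \<or> x ** u \<in> K")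
    case True
    have uH: "u \<in> H" using u by (simp add: cong_subgroup_def)
    show ?thesis
    proof (cases "x \<in> K")
      case False
      then have "\<phi> (x ** u ** matrix_inv u) = \<phi> (x ** u)"
        using True on_K inv_cong_subgroup[OF \<epsilon>(1,2) u] by blast
      then show ?thesis using uH by (simp add: mult_inv flip: matrix_mul_assoc)
    qed (use on_K u in auto)
  next
    case False
    moreover have "x ** u \<in> H" using x u mult_mem by (simp add: cong_subgroup_def)
    ultimately show ?thesis using K(3) x by metis
  qed
  then show ?thesis using that openin_cong_subgroup one_cong_subgroup \<epsilon>(1) by blast
qed

end

section \<open>Integrals of vector valued functions\<close>

text \<open>
  Coordinates turn the finite sums that define integrals of vectors into ordinary integrals, for which
  linearity and the integration formula of the quotient measure are available.
\<close>

lemma has_bochner_integral_lookup: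
  assumes fin: "finite (f ` space M)"
    and lev: "\<And>w. w \<noteq> 0 \<Longrightarrow> {x \<in> space M. f x = w} \<in> sets M \<and> emeasure M {x \<in> space M. f x = w} < \<infinity>"
  shows "has_bochner_integral M (\<lambda>x. Poly_Mapping.lookup (f x) i) (Poly_Mapping.lookup (simple_integral M f) i)"
proof -
  define W where "W = f ` space M - {0}"
  have W: "finite W" "0 \<notin> W" using fin by (auto simp: W_def)
  define D where "D w = {x \<in> space M. f x = w}" for w
  have "has_bochner_integral M (\<lambda>x. \<Sum>w\<in>W. indicator (D w) x *\<^sub>R Poly_Mapping.lookup w i)
          (\<Sum>w\<in>W. measure M (D w) *\<^sub>R Poly_Mapping.lookup w i)"
  proof (intro has_bochner_integral_sum has_bochner_integral_indicator)
    fix w assume "w \<in> W"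
    then have "w \<noteq> 0" using W by blast
    then show "D w \<in> sets M" "emeasure M (D w) < \<infinity>" using lev by (simp_all add: D_def)
  qed
  moreover have "(\<Sum>w\<in>W. measure M (D w) *\<^sub>R Poly_Mapping.lookup w i) = Poly_Mapping.lookup (simple_integral M f) i"
    by (simp add: simple_integral_def lookup_sum lookup_cscale W_def D_def scaleR_conv_of_real)
  moreover have "(\<Sum>w\<in>W. indicator (D w) x *\<^sub>R Poly_Mapping.lookup w i) = Poly_Mapping.lookup (f x) i" if x: "x \<in> space M" for x
  proof -
    have "(\<Sum>w\<in>W. indicator (D w) x *\<^sub>R Poly_Mapping.lookup w i)
        = (\<Sum>w\<in>W. if f x = w then Poly_Mapping.lookup w i else 0)"
      by (intro sum.cong) (auto simp: D_def x)
    also have "\<dots> = Poly_Mapping.lookup (f x) i"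
      using W x by (auto simp: sum.delta' W_def)
    finally show ?thesis .
  qed
  ultimately show ?thesis
    by (simp cong: has_bochner_integral_cong)
qed

text \<open>
  The quotient measure is characterized by the integrals of functions that come from test functions.  This Markov
  bound extracts the finiteness of the measure of level sets from their integrability.
\<close>

lemma emeasure_level_set_integrable:
  fixes f :: "'a \<Rightarrow> complex"
  assumes "integrable M f" "c \<noteq> 0"
  shows "emeasure M {x \<in> space M. f x = c} < \<infinity>"
proof -
  have "emeasure M {x \<in> space M. f x = c} \<le> emeasure M {x \<in> space M. cmod (f x) \<ge> cmod c}"
    using assms by (intro emeasure_mono) auto
  also have "\<dots> \<le> ennreal ((1 / cmod c) * (\<integral>x. cmod (f x) \<partial>M))"
    using assms integral_Markov_inequality[of M "\<lambda>x. cmod (f x)" "cmod c"] by auto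
  also have "\<dots> < \<infinity>" by simp
  finally show ?thesis .
qed

context padic_matrix_group begin

lemma smooth_rep_locally_constant:
  assumes "smooth_rep H \<pi>" "v \<in> rep_space \<pi>"
  shows "locally_constant_on H (\<lambda>m. rep_act \<pi> m v)"
proof (rule locally_constant_onI_right)
  fix x assume x: "x \<in> H"
  have "rep_act \<pi> (x ** u) v = rep_act \<pi> x v" if "u \<in> {m \<in> H. rep_act \<pi> m v = v}" for u
    using assms x that unfolding smooth_rep_def by auto
  moreover have "openin (top_of_set H) {m \<in> H. rep_act \<pi> m v = v}"
    "mat 1 \<in> {m \<in> H. rep_act \<pi> m v = v}"
    using assms one_mem unfolding smooth_rep_def by auto
  ultimately show "\<exists>U. openin (top_of_set H) U \<and> mat 1 \<in> U \<and> (\<forall>u\<in>U. rep_act \<pi> (x ** u) v = rep_act \<pi> x v)"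
    by blast
qed

end

lemma Cc_inf_mult:
  assumes "\<phi> \<in> Cc_inf H" "locally_constant_on H f"
  shows "(\<lambda>m. \<phi> m * f m) \<in> Cc_inf H"
proof -
  obtain K where K: "K \<subseteq> H" "compact K" "\<forall>m\<in>H. \<phi> m \<noteq> 0 \<longrightarrow> m \<in> K" and lc: "locally_constant_on H \<phi>"
    using assms(1) unfolding Cc_inf_def by blast
  have "locally_constant_on H (\<lambda>m. \<phi> m * f m)"
    using lc assms(2) by (rule locally_constant_on_combine)
  moreover have "\<forall>m\<in>H. \<phi> m * f m \<noteq> 0 \<longrightarrow> m \<in> K" using K(3) by simp
  ultimately show ?thesis
    unfolding Cc_inf_def using K(1,2) by (intro CollectI conjI exI[of _ K])
qed

lemma haar_has_bochner_integral_lookup: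
  fixes f :: "'f::padic_field^'n^'n \<Rightarrow> cvec"
  assumes "haar_measure H \<mu>" "locally_constant_on H f"
    and "compact K" "K \<subseteq> H" "\<And>m. m \<in> H \<Longrightarrow> f m \<noteq> 0 \<Longrightarrow> m \<in> K"
  shows "has_bochner_integral \<mu> (\<lambda>x. Poly_Mapping.lookup (f x) i) (Poly_Mapping.lookup (simple_integral \<mu> f) i)"
proof (rule has_bochner_integral_lookup)
  have sp: "space \<mu> = H" "sets \<mu> = sets (restrict_space borel H)" and fin: "emeasure \<mu> K < \<infinity>"
    using assms unfolding haar_measure_def by auto
  have "f ` H \<subseteq> insert 0 (f ` K)" using assms by auto
  moreover have "finite (f ` K)" using finite_image_locally_constant assms by blast
  ultimately show "finite (f ` space \<mu>)" using sp by (metis finite.insertI finite_subset)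
  fix w :: cvec assume "w \<noteq> 0"
  have "openin (top_of_set H) {x \<in> H. f x = w}" using assms(2) by (simp add: locally_constant_on_iff)
  then obtain W where W: "open W" "{x \<in> H. f x = w} = H \<inter> W" unfolding openin_open by blast
  then have m: "{x \<in> H. f x = w} \<in> sets \<mu>"
    unfolding sp sets_restrict_space by (metis borel_open image_eqI)
  have "H \<inter> K = K" "K \<in> sets borel" using assms(3,4) by (auto intro: borel_closed compact_imp_closed)
  then have "K \<in> sets \<mu>"
    unfolding sp sets_restrict_space by (metis image_eqI)
  then have "emeasure \<mu> {x \<in> H. f x = w} \<le> emeasure \<mu> K"
    using assms(5) \<open>w \<noteq> 0\<close> by (intro emeasure_mono) auto
  then show "{x \<in> space \<mu>. f x = w} \<in> sets \<mu> \<and> emeasure \<mu> {x \<in> space \<mu>. f x = w} < \<infinity>"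
    using m fin sp by (simp add: le_less_trans)
qed

text \<open>
  The basis used for the trace is chosen in terms of the image alone.  Since the image is a subspace, the
  choice succeeds, and the basis lies in \<open>V\<close>, where the two operators agree.
\<close>

lemma finite_rank_trace_cong:
  assumes "\<And>v. v \<in> V \<Longrightarrow> T v = T' v" "T ` V \<subseteq> V" "cvs.subspace (T ` V)"
  shows "finite_rank_trace V T = finite_rank_trace V T'"
proof -
  have im: "T ` V = T' ` V" using assms(1) by auto
  define B where "B = (SOME B. cvs.independent B \<and> cvs.span B = T ` V)"
  have "\<exists>B. cvs.independent B \<and> cvs.span B = T ` V"
    using cvs.maximal_independent_subset[of "T ` V"] assms(3)
    by (metis cvs.span_minimal cvs.span_superset subset_antisym)
  then have "cvs.independent B \<and> cvs.span B = T ` V"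
    unfolding B_def by (rule someI_ex)
  then have "B \<subseteq> V" using assms(2) cvs.span_superset by blast
  then show ?thesis
    unfolding finite_rank_trace_def Let_def im[symmetric] B_def[symmetric]
    using assms(1) by (intro sum.cong) auto
qed

section \<open>Projection along the centre\<close>

locale central_quotient = padic_matrix_group H + Z: padic_matrix_group Z
  for H Z :: "('f::padic_field^'n^'n) set" +
  assumes Z_sub: "Z \<subseteq> H"
    and central: "\<And>z h. z \<in> Z \<Longrightarrow> h \<in> H \<Longrightarrow> z ** h = h ** z"
begin

lemma carrier_Mod: "carrier (mat_group H Mod Z) = {{z ** a |z. z \<in> Z} |a. a \<in> H}"
  by (auto simp: FactGroup_def RCOSETS_def r_coset_def mat_group_def)

lemma coset_rep_in:
  assumes "C \<in> carrier (mat_group H Mod Z)"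
  shows "coset_rep C \<in> C" "C \<subseteq> H" "coset_rep C \<in> H"
    "m \<in> C \<Longrightarrow> \<exists>z\<in>Z. m = z ** coset_rep C"
proof -
  obtain a where a: "a \<in> H" "C = {z ** a |z. z \<in> Z}" using assms by (auto simp: carrier_Mod)
  then have "mat 1 ** a \<in> C" using Z.one_mem by blast
  then show r: "coset_rep C \<in> C" unfolding coset_rep_def by (rule someI)
  show s: "C \<subseteq> H" using a Z_sub mult_mem by auto
  show "coset_rep C \<in> H" using r s by blast
  assume "m \<in> C"
  then obtain z z0 where z: "z \<in> Z" "z0 \<in> Z" "m = z ** a" "coset_rep C = z0 ** a" using a r by auto
  then have "m = (z ** matrix_inv z0) ** coset_rep C"
    by (simp flip: matrix_mul_assoc)
  then show "\<exists>z\<in>Z. m = z ** coset_rep C" using z Z.mult_mem Z.inv_mem by blast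
qed

lemma in_coset: "a \<in> H \<Longrightarrow> \<exists>C\<in>carrier (mat_group H Mod Z). a \<in> C"
proof -
  assume a: "a \<in> H"
  have "a \<in> {z ** a |z. z \<in> Z}" using Z.one_mem by (auto intro!: exI[of _ "mat 1"])
  moreover have "{z ** a |z. z \<in> Z} \<in> carrier (mat_group H Mod Z)"
    unfolding carrier_Mod by (rule CollectI, rule exI[of _ a]) (simp add: a)
  ultimately show ?thesis by (rule bexI)
qed

lemma quotient_level_set:
  assumes "quotient_measure H Z \<mu> \<nu> \<kappa>" "locally_constant_on H g"
    and "\<And>z m. z \<in> Z \<Longrightarrow> m \<in> H \<Longrightarrow> g (z ** m) = g m"
  shows "{C \<in> space \<kappa>. g (coset_rep C) = w} \<in> sets \<kappa>"
proof -
  define S where "S = {C \<in> carrier (mat_group H Mod Z). g (coset_rep C) = w}"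
  have gC: "g m = g (coset_rep C)" if "C \<in> carrier (mat_group H Mod Z)" "m \<in> C" for m C
    using coset_rep_in[OF that(1)] that assms(3) by metis
  have "\<Union>S = {m \<in> H. g m = w}"
  proof (intro Set.set_eqI iffI)
    fix m assume "m \<in> \<Union>S"
    then obtain C where C: "C \<in> carrier (mat_group H Mod Z)" "m \<in> C" "g (coset_rep C) = w"
      unfolding S_def by blast
    then show "m \<in> {m \<in> H. g m = w}" using gC[OF C(1,2)] coset_rep_in(2)[OF C(1)] by auto
  next
    fix m assume m: "m \<in> {m \<in> H. g m = w}"
    then obtain C where C: "C \<in> carrier (mat_group H Mod Z)" "m \<in> C" using in_coset by blast
    then show "m \<in> \<Union>S" using gC[OF C] m by (auto simp: S_def)
  qed
  then have "openin (top_of_set H) (\<Union>S)" using assms(2) by (simp add: locally_constant_on_iff)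
  moreover have "S \<subseteq> carrier (mat_group H Mod Z)" by (auto simp: S_def)
  moreover have "{C \<in> space \<kappa>. g (coset_rep C) = w} = S"
    using assms(1) by (simp add: quotient_measure_def S_def)
  ultimately show ?thesis
    using assms(1) by (simp add: quotient_measure_def)
qed

context
  fixes \<nu> :: "('f^'n^'n) measure" and \<omega> \<phi> :: "'f^'n^'n \<Rightarrow> complex"
  assumes haarZ: "haar_measure Z \<nu>" and omega: "unitary_character Z \<omega>" and phi: "\<phi> \<in> Cc_inf H"
begin

definition central_projection :: "'f^'n^'n \<Rightarrow> complex" where
  "central_projection m = (\<integral>z. \<omega> z * \<phi> (z ** m) \<partial>\<nu>)"

lemma space_nu: "space \<nu> = Z" "sets \<nu> = sets (restrict_space borel Z)"
  using haarZ by (auto simp: haar_measure_def)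

lemma omega_mult: "x \<in> Z \<Longrightarrow> y \<in> Z \<Longrightarrow> \<omega> (x ** y) = \<omega> x * \<omega> y"
  and omega_nz: "x \<in> Z \<Longrightarrow> \<omega> x \<noteq> 0"
  using omega by (auto simp: unitary_character_def dest!: bspec[of _ _ x])

lemma central_projection_locally_constant: "locally_constant_on H central_projection"
proof -
  obtain U where U: "openin (top_of_set H) U" "mat 1 \<in> U"
    "\<And>x u. x \<in> H \<Longrightarrow> u \<in> U \<Longrightarrow> \<phi> (x ** u) = \<phi> x"
    using Cc_inf_uniformly_locally_constant[OF phi] by metis
  show ?thesis
  proof (rule locally_constant_onI_right)
    fix x assume x: "x \<in> H"
    have "central_projection (x ** u) = central_projection x" if "u \<in> U" for u
      unfolding central_projection_def
    proof (intro Bochner_Integration.integral_cong refl)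
      fix z assume "z \<in> space \<nu>"
      then have "z ** x \<in> H" using space_nu Z_sub x mult_mem by auto
      then show "\<omega> z * \<phi> (z ** (x ** u)) = \<omega> z * \<phi> (z ** x)"
        using U(3)[OF _ that] by (simp add: matrix_mul_assoc)
    qed
    then show "\<exists>U. openin (top_of_set H) U \<and> mat 1 \<in> U \<and> (\<forall>u\<in>U. central_projection (x ** u) = central_projection x)"
      using U by blast
  qed
qed

text \<open>
  Substitute \<open>z0 z\<close> for \<open>z\<close>: translation by \<open>z0\<close> preserves \<open>\<nu>\<close>, and \<open>Z\<close> is commutative.
\<close>

lemma central_projection_equivariant:
  assumes z0: "z0 \<in> Z" and m: "m \<in> H"
  shows "central_projection (z0 ** m) = inverse (\<omega> z0) * central_projection m"
proof -
  have zH: "z ** m \<in> H" if "z \<in> Z" for z using that m Z_sub mult_mem by blast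
  define f where "f z = \<omega> z * \<phi> (z ** m)" for z
  have "continuous_on Z (\<lambda>z. \<phi> (z ** m))"
  proof (rule continuous_on_compose2[where g = \<phi> and t = H])
    show "continuous_on H \<phi>" using phi continuous_on_locally_constant by (auto simp: Cc_inf_def)
  qed (use zH in \<open>auto intro: continuous_on_matrix_mult_right\<close>)
  then have "continuous_on Z f"
    unfolding f_def using omega by (auto simp: unitary_character_def intro!: continuous_intros)
  then have meas_f: "f \<in> borel_measurable \<nu>"
    using borel_measurable_continuous_on_restrict measurable_cong_sets[OF space_nu(2) refl] by blast
  have inv: "emeasure \<nu> ((**) g ` S) = emeasure \<nu> S" if "g \<in> Z" "S \<in> sets \<nu>" for g S
    using haarZ that by (auto simp: haar_measure_def)
  have meas_t: "(**) z0 \<in> measurable \<nu> \<nu>"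
  proof -
    have "continuous_on Z ((**) z0)" by (rule continuous_on_matrix_mult_left)
    then have "(**) z0 \<in> borel_measurable (restrict_space borel Z)"
      by (rule borel_measurable_continuous_on_restrict)
    then have "(**) z0 \<in> measurable (restrict_space borel Z) (restrict_space borel Z)"
      using z0 Z.mult_mem by (intro measurable_restrict_space2) (auto simp: space_restrict_space)
    then show ?thesis using measurable_cong_sets[OF space_nu(2) space_nu(2)] by blast
  qed
  have "distr \<nu> \<nu> ((**) z0) = \<nu>"
  proof (rule measure_eqI)
    fix S assume "S \<in> sets (distr \<nu> \<nu> ((**) z0))"
    then have S: "S \<in> sets \<nu>" by simp
    then have SZ: "S \<subseteq> Z" using space_nu sets.sets_into_space by blast
    have "(**) z0 -` S \<inter> space \<nu> = (**) (matrix_inv z0) ` S"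
    proof (intro Set.set_eqI iffI)
      fix z assume "z \<in> (**) z0 -` S \<inter> space \<nu>"
      then show "z \<in> (**) (matrix_inv z0) ` S" using z0 
        by (intro image_eqI[of _ _ "z0 ** z"]) auto
    next
      fix z assume "z \<in> (**) (matrix_inv z0) ` S"
      then show "z \<in> (**) z0 -` S \<inter> space \<nu>"
        using z0 SZ Z.inv_mem Z.mult_mem space_nu(1) by auto
    qed
    then show "emeasure (distr \<nu> \<nu> ((**) z0)) S = emeasure \<nu> S"
      using S meas_t inv[of "matrix_inv z0" S] z0 Z.inv_mem by (simp add: emeasure_distr)
  qed simp
  then have "central_projection m = (\<integral>z. f z \<partial>distr \<nu> \<nu> ((**) z0))"
    by (simp add: central_projection_def f_def)
  also have "\<dots> = (\<integral>z. f (z0 ** z) \<partial>\<nu>)"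
    by (rule integral_distr[OF meas_t meas_f])
  also have "\<dots> = (\<integral>z. \<omega> z0 * (\<omega> z * \<phi> (z ** (z0 ** m))) \<partial>\<nu>)"
  proof (intro Bochner_Integration.integral_cong refl)
    fix z assume "z \<in> space \<nu>"
    then have z: "z \<in> Z" by (simp add: space_nu)
    then have "z0 ** z = z ** z0" using central z0 Z_sub by blast
    then show "f (z0 ** z) = \<omega> z0 * (\<omega> z * \<phi> (z ** (z0 ** m)))"
      using z z0 by (simp add: f_def omega_mult matrix_mul_assoc)
  qed
  also have "\<dots> = \<omega> z0 * central_projection (z0 ** m)"
    by (simp add: central_projection_def)
  finally show ?thesis using omega_nz[OF z0] by (simp add: field_simps)
qed

lemma central_projection_support:
  assumes "m \<in> H" "central_projection m \<noteq> 0" "\<forall>m\<in>H. \<phi> m \<noteq> 0 \<longrightarrow> m \<in> K"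
  shows "\<exists>z\<in>Z. \<exists>k\<in>K. m = z ** k"
proof -
  have "\<exists>z\<in>Z. \<phi> (z ** m) \<noteq> 0"
  proof (rule ccontr)
    assume "\<not> (\<exists>z\<in>Z. \<phi> (z ** m) \<noteq> 0)"
    then have "central_projection m = (\<integral>z. 0 \<partial>\<nu>)"
      unfolding central_projection_def by (intro Bochner_Integration.integral_cong) (auto simp: space_nu)
    then show False using assms by simp
  qed
  then obtain z where z: "z \<in> Z" "\<phi> (z ** m) \<noteq> 0" by blast
  then have "z ** m \<in> K" using assms Z_sub mult_mem by blast
  moreover have "m = matrix_inv z ** (z ** m)" using z by simp
  ultimately show ?thesis using Z.inv_mem z by blast
qed

lemma central_projection_Cc_inf_mod: "central_projection \<in> Cc_inf_mod H Z \<omega>"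
proof -
  obtain K where K: "K \<subseteq> H" "compact K" "\<forall>m\<in>H. \<phi> m \<noteq> 0 \<longrightarrow> m \<in> K"
    using phi unfolding Cc_inf_def by blast
  have "\<forall>m\<in>H. central_projection m \<noteq> 0 \<longrightarrow> (\<exists>z\<in>Z. \<exists>k\<in>K. m = z ** k)"
    using central_projection_support K(3) by blast
  moreover have "\<forall>z\<in>Z. \<forall>m\<in>H. central_projection (z ** m) = inverse (\<omega> z) * central_projection m"
    using central_projection_equivariant by blast
  ultimately show ?thesis
    unfolding Cc_inf_mod_def using central_projection_locally_constant K(1,2) by (intro CollectI conjI exI[of _ K])
qed

text \<open>
  Both operators are compared one coordinate at a time.  The integrand over \<open>H\<close> is then a test function
  \<open>F\<close>, and its integral over the fibre through \<open>x\<close> is the corresponding coordinate of the integrand over \<open>H / Z\<close>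
  because the central character of \<open>\<pi>\<close> turns \<open>\<pi>(zx)\<close> into \<open>\<omega>(z)\<pi>(x)\<close>.
\<close>

lemma trace_central_projection:
  assumes haarH: "haar_measure H \<mu>" and quot: "quotient_measure H Z \<mu> \<nu> \<kappa>"
    and smooth: "smooth_rep H \<pi>" and cc: "has_central_character Z \<omega> \<pi>"
  shows "trace_rep_mod \<kappa> \<pi> central_projection = trace_rep \<mu> \<pi> \<phi>"
proof -
  let ?V = "rep_space \<pi>"
  define f where "f v m = cscale (\<phi> m) (rep_act \<pi> m v)" for v m
  define g where "g v m = cscale (central_projection m) (rep_act \<pi> m v)" for v m
  define T where "T v = simple_integral \<mu> (f v)" for v
  define T' where "T' v = simple_integral \<kappa> (\<lambda>C. g v (coset_rep C))" for v
  obtain K where K: "K \<subseteq> H" "compact K" "\<forall>m\<in>H. \<phi> m \<noteq> 0 \<longrightarrow> m \<in> K"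
    using phi unfolding Cc_inf_def by blast
  have quot_formula: "\<forall>f\<in>Cc_inf H. integrable \<kappa> (\<lambda>C. \<integral>z. f (z ** coset_rep C) \<partial>\<nu>) \<and>
      (\<integral>m. f m \<partial>\<mu>) = (\<integral>C. (\<integral>z. f (z ** coset_rep C) \<partial>\<nu>) \<partial>\<kappa>)"
    using quot unfolding quotient_measure_def by (elim conjE)
  have phi_lc: "locally_constant_on H \<phi>" using phi by (simp add: Cc_inf_def)
  have sub: "cvs.subspace ?V" using smooth by (simp add: smooth_rep_def)
  have act_V: "rep_act \<pi> m v \<in> ?V" if "m \<in> H" "v \<in> ?V" for m v
    using smooth that by (simp add: smooth_rep_def)
  have act_mult: "rep_act \<pi> (x ** y) v = rep_act \<pi> x (rep_act \<pi> y v)" if "x \<in> H" "y \<in> H" "v \<in> ?V" for x y v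
    using smooth that by (simp add: smooth_rep_def)
  have act_lin: "clinear_on ?V (rep_act \<pi> m)" if "m \<in> H" for m
    using smooth that by (simp add: smooth_rep_def)
  have act_Z: "rep_act \<pi> (z ** x) v = cscale (\<omega> z) (rep_act \<pi> x v)" if "z \<in> Z" "x \<in> H" "v \<in> ?V" for z x v
    using that cc act_mult Z_sub act_V by (auto simp: has_central_character_def)
  have lc_act: "locally_constant_on H (\<lambda>m. rep_act \<pi> m v)" if "v \<in> ?V" for v
    using smooth_rep_locally_constant[OF smooth that] .
  have T: "has_bochner_integral \<mu> (\<lambda>x. Poly_Mapping.lookup (f v x) i) (Poly_Mapping.lookup (T v) i)" if v: "v \<in> ?V" for v i
    unfolding T_def
  proof (rule haar_has_bochner_integral_lookup[OF haarH _ K(2,1)])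
    show "locally_constant_on H (f v)"
      unfolding f_def using phi_lc lc_act[OF v] by (rule locally_constant_on_combine)
    show "m \<in> K" if "m \<in> H" "f v m \<noteq> 0" for m
      using that K by (auto simp: f_def)
  qed
  have g_lc: "locally_constant_on H (g v)" if "v \<in> ?V" for v
    unfolding g_def using central_projection_locally_constant lc_act[OF that] by (rule locally_constant_on_combine)
  have g_Z: "g v (z ** m) = g v m" if "v \<in> ?V" "z \<in> Z" "m \<in> H" for v z m
    using that by (simp add: g_def central_projection_equivariant act_Z omega_nz)
  have TT': "T v = T' v" if v: "v \<in> ?V" for v
  proof (rule poly_mapping_eqI)
    fix i
    define F where "F i m = \<phi> m * Poly_Mapping.lookup (rep_act \<pi> m v) i" for i m
    have F: "F i \<in> Cc_inf H" for i
      unfolding F_def by (rule Cc_inf_mult[OF phi locally_constant_on_compose_fun[OF lc_act[OF v]]])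
    have fibre: "(\<integral>z. F i (z ** x) \<partial>\<nu>) = Poly_Mapping.lookup (g v x) i" if x: "x \<in> H" for x i
    proof -
      have "(\<integral>z. F i (z ** x) \<partial>\<nu>) = (\<integral>z. (\<omega> z * \<phi> (z ** x)) * Poly_Mapping.lookup (rep_act \<pi> x v) i \<partial>\<nu>)"
        by (intro Bochner_Integration.integral_cong) (auto simp: F_def space_nu act_Z x v lookup_cscale)
      then show ?thesis by (simp add: g_def lookup_cscale central_projection_def)
    qed
    have spk: "space \<kappa> = carrier (mat_group H Mod Z)" using quot by (simp add: quotient_measure_def)
    have rep: "coset_rep C \<in> H" if "C \<in> space \<kappa>" for C using coset_rep_in(3) that unfolding spk .
    have int: "integrable \<kappa> (\<lambda>C. Poly_Mapping.lookup (g v (coset_rep C)) i)"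
      "(\<integral>m. F i m \<partial>\<mu>) = (\<integral>C. Poly_Mapping.lookup (g v (coset_rep C)) i \<partial>\<kappa>)" for i
    proof -
      have *: "integrable \<kappa> (\<lambda>C. \<integral>z. F i (z ** coset_rep C) \<partial>\<nu>)"
        "(\<integral>m. F i m \<partial>\<mu>) = (\<integral>C. (\<integral>z. F i (z ** coset_rep C) \<partial>\<nu>) \<partial>\<kappa>)"
        using bspec[OF quot_formula F[of i]] by simp_all
      show "integrable \<kappa> (\<lambda>C. Poly_Mapping.lookup (g v (coset_rep C)) i)"
        using *(1) fibre rep by (simp cong: Bochner_Integration.integrable_cong)
      show "(\<integral>m. F i m \<partial>\<mu>) = (\<integral>C. Poly_Mapping.lookup (g v (coset_rep C)) i \<partial>\<kappa>)"
        using *(2) fibre rep by (simp cong: Bochner_Integration.integral_cong)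
    qed
    have T': "has_bochner_integral \<kappa> (\<lambda>C. Poly_Mapping.lookup (g v (coset_rep C)) i) (Poly_Mapping.lookup (T' v) i)" for i
      unfolding T'_def
    proof (rule has_bochner_integral_lookup)
      \<comment> \<open>Modulo \<open>Z\<close> the integrand is supported on \<open>K\<close>, where it takes finitely many values.\<close>
      have "g v m \<in> insert 0 (g v ` K)" if m: "m \<in> H" for m
      proof (cases "central_projection m = 0")
        case False
        then obtain z k where "z \<in> Z" "k \<in> K" "m = z ** k" using central_projection_support[OF m False K(3)] by blast
        then show ?thesis using g_Z[OF v] K(1) by auto
      qed (simp add: g_def)
      then have "(\<lambda>C. g v (coset_rep C)) ` space \<kappa> \<subseteq> insert 0 (g v ` K)" using rep by auto
      moreover have "finite (g v ` K)" using finite_image_locally_constant[OF g_lc[OF v] K(2,1)] .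
      ultimately show "finite ((\<lambda>C. g v (coset_rep C)) ` space \<kappa>)" by (meson finite.insertI finite_subset)
      fix w :: cvec assume "w \<noteq> 0"
      then obtain j where j: "Poly_Mapping.lookup w j \<noteq> 0" by (metis poly_mapping_eqI lookup_zero)
      have m: "{C \<in> space \<kappa>. g v (coset_rep C) = w} \<in> sets \<kappa>"
        using quotient_level_set[OF quot g_lc[OF v] g_Z[OF v]] .
      have "{C \<in> space \<kappa>. Poly_Mapping.lookup (g v (coset_rep C)) j = Poly_Mapping.lookup w j} \<in> sets \<kappa>"
        using borel_measurable_integrable[OF int(1)] by measurable
      then have "emeasure \<kappa> {C \<in> space \<kappa>. g v (coset_rep C) = w}
          \<le> emeasure \<kappa> {C \<in> space \<kappa>. Poly_Mapping.lookup (g v (coset_rep C)) j = Poly_Mapping.lookup w j}"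
        by (intro emeasure_mono) auto
      also have "\<dots> < \<infinity>" using emeasure_level_set_integrable[OF int(1) j] .
      finally show "{C \<in> space \<kappa>. g v (coset_rep C) = w} \<in> sets \<kappa> \<and> emeasure \<kappa> {C \<in> space \<kappa>. g v (coset_rep C) = w} < \<infinity>"
        using m by blast
    qed
    have "Poly_Mapping.lookup (T v) i = (\<integral>m. F i m \<partial>\<mu>)"
      using has_bochner_integral_integral_eq[OF T[OF v]] by (simp add: F_def f_def lookup_cscale)
    also have "\<dots> = Poly_Mapping.lookup (T' v) i"
      using has_bochner_integral_integral_eq[OF T'] int(2) by simp
    finally show "Poly_Mapping.lookup (T v) i = Poly_Mapping.lookup (T' v) i" .
  qed
  have spm: "space \<mu> = H" using haarH by (simp add: haar_measure_def)
  have TV: "T v \<in> ?V" if "v \<in> ?V" for v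
    unfolding T_def simple_integral_def
    using that by (intro cvs.subspace_sum[OF sub] cvs.subspace_scale[OF sub])
       (auto simp: f_def spm intro!: cvs.subspace_scale[OF sub] act_V)
  have T_add: "T (u + v) = T u + T v" if "u \<in> ?V" "v \<in> ?V" for u v
  proof (rule poly_mapping_eqI)
    fix i
    have uv: "u + v \<in> ?V" using that sub by (simp add: cvs.subspace_add)
    have "has_bochner_integral \<mu> (\<lambda>x. Poly_Mapping.lookup (f u x) i + Poly_Mapping.lookup (f v x) i)
        (Poly_Mapping.lookup (T u) i + Poly_Mapping.lookup (T v) i)"
      using T that by (intro has_bochner_integral_add)
    moreover have "Poly_Mapping.lookup (f u x) i + Poly_Mapping.lookup (f v x) i = Poly_Mapping.lookup (f (u + v) x) i"
      if "x \<in> space \<mu>" for x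
      using act_lin[of x] that spm \<open>u \<in> ?V\<close> \<open>v \<in> ?V\<close>
      by (simp add: f_def clinear_on_def lookup_cscale lookup_add algebra_simps)
    ultimately have "has_bochner_integral \<mu> (\<lambda>x. Poly_Mapping.lookup (f (u + v) x) i)
        (Poly_Mapping.lookup (T u) i + Poly_Mapping.lookup (T v) i)"
      by (simp cong: has_bochner_integral_cong)
    then show "Poly_Mapping.lookup (T (u + v)) i = Poly_Mapping.lookup (T u + T v) i"
      using has_bochner_integral_eq[OF T[OF uv]] by (simp add: lookup_add)
  qed
  have T_scale: "T (cscale c v) = cscale c (T v)" if "v \<in> ?V" for c v
  proof (rule poly_mapping_eqI)
    fix i
    have cv: "cscale c v \<in> ?V" using that sub by (simp add: cvs.subspace_scale)
    have "has_bochner_integral \<mu> (\<lambda>x. c * Poly_Mapping.lookup (f v x) i) (c * Poly_Mapping.lookup (T v) i)"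
      using T that by (intro has_bochner_integral_mult_right)
    moreover have "c * Poly_Mapping.lookup (f v x) i = Poly_Mapping.lookup (f (cscale c v) x) i"
      if "x \<in> space \<mu>" for x
      using act_lin[of x] that spm \<open>v \<in> ?V\<close>
      by (simp add: f_def clinear_on_def lookup_cscale)
    ultimately have "has_bochner_integral \<mu> (\<lambda>x. Poly_Mapping.lookup (f (cscale c v) x) i) (c * Poly_Mapping.lookup (T v) i)"
      by (simp cong: has_bochner_integral_cong)
    then show "Poly_Mapping.lookup (T (cscale c v)) i = Poly_Mapping.lookup (cscale c (T v)) i"
      using has_bochner_integral_eq[OF T[OF cv]] by (simp add: lookup_cscale)
  qed
  have "cvs.subspace (T ` ?V)"
  proof (rule cvs.subspaceI)
    have "T 0 = cscale 0 (T 0)" using T_scale[of 0 0] sub by (simp add: cvs.subspace_0)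
    then have "T 0 = 0" by simp
    then show "0 \<in> T ` ?V" using sub by (metis cvs.subspace_0 image_eqI)
  next
    fix x y assume "x \<in> T ` ?V" "y \<in> T ` ?V"
    then obtain u v where "x = T u" "u \<in> ?V" "y = T v" "v \<in> ?V" by blast
    then show "x + y \<in> T ` ?V" using T_add sub by (metis cvs.subspace_add image_eqI)
  next
    fix c x assume "x \<in> T ` ?V"
    then obtain u where "x = T u" "u \<in> ?V" by blast
    then show "cscale c x \<in> T ` ?V" using T_scale sub by (metis cvs.subspace_scale image_eqI)
  qed
  then have "finite_rank_trace ?V T = finite_rank_trace ?V T'"
    using TT' TV by (intro finite_rank_trace_cong) auto
  then show ?thesis
    unfolding trace_rep_def trace_rep_mod_def T_def[abs_def] T'_def[abs_def] f_def g_def by (rule sym)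
qed

end
end

section \<open>Points over the base field\<close>

lemma matrix_group_general_linear: "matrix_group {g :: 'k::field^'n^'n. invertible g}"
proof
  show "mat 1 \<in> {g :: 'k^'n^'n. invertible g}"
    by (auto simp: invertible_def intro!: exI[of _ "mat 1"])
  show "x ** y \<in> {g :: 'k^'n^'n. invertible g}" if "x \<in> {g. invertible g}" "y \<in> {g. invertible g}" for x y :: "'k^'n^'n"
    using that invertible_mult by blast
  show "invertible x \<and> matrix_inv x \<in> {g. invertible g}" if "x \<in> {g. invertible g}" for x :: "'k^'n^'n"
    using that matrix_inv_mult[of x] unfolding mem_Collect_eq by (metis invertible_def)
qed

lemma inv_mat_group:
  assumes "matrix_group H" "x \<in> H"
  shows "inv\<^bsub>mat_group H\<^esub> x = matrix_inv x"
proof -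
  interpret matrix_group H by fact
  show ?thesis
    by (rule group.inv_equality[OF group_mat_group])
       (use assms(2) inv_mem mult_inv in \<open>simp_all add: mat_group_def\<close>)
qed

lemma alg_subgroup_matrix_group:
  fixes M :: "('k::field^'n^'n) set"
  assumes "alg_subgroup R M"
  shows "matrix_group M"
proof
  have s: "subgroup M (mat_group {g. invertible g})" using assms by (simp add: alg_subgroup_def)
  show "mat 1 \<in> M" using subgroup.one_closed[OF s] by (simp add: mat_group_def)
  show "x ** y \<in> M" if "x \<in> M" "y \<in> M" for x y
    using subgroup.m_closed[OF s that] by (simp add: mat_group_def)
  show "invertible x \<and> matrix_inv x \<in> M" if x: "x \<in> M" for x
  proof -
    have "invertible x" using subgroup.subset[OF s] x by (auto simp: mat_group_def)
    then show ?thesis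
      using subgroup.m_inv_closed[OF s x] inv_mat_group[OF matrix_group_general_linear, of x] by simp
  qed
qed

lemma map_matrix_to_ac_mult:
  "map_matrix to_ac (x ** y) = map_matrix to_ac x ** map_matrix to_ac (y :: 'f::field^'n^'n)"
  by (simp add: vec_eq_iff matrix_matrix_mult_def to_ac_sum)

lemma map_matrix_to_ac_one [simp]: "map_matrix to_ac (mat 1 :: 'f::field^'n^'n) = mat 1"
  by (simp add: vec_eq_iff mat_def)

lemma map_matrix_to_ac_eq_iff: "map_matrix to_ac x = map_matrix to_ac y \<longleftrightarrow> x = (y :: 'f::field^'n^'n)"
  by (auto simp: vec_eq_iff)

lemma det_map_matrix_to_ac: "det (map_matrix to_ac x) = to_ac (det (x :: 'f::field^'n^'n))"
  by (simp add: det_def to_ac_sum to_ac_prod)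

text \<open>
  The inverse of a matrix over \<open>F\<close> is already defined over \<open>F\<close>, since invertibility is detected by the determinant.
\<close>

lemma F_points_matrix_group:
  fixes M :: "('f::field alg_closure^'n^'n) set"
  assumes "matrix_group M"
  shows "matrix_group (F_points M)"
proof
  interpret matrix_group M by fact
  show "mat 1 \<in> F_points M" by (simp add: F_points_def one_mem)
  show "x ** y \<in> F_points M" if "x \<in> F_points M" "y \<in> F_points M" for x y
    using that by (simp add: F_points_def map_matrix_to_ac_mult mult_mem)
  show "invertible x \<and> matrix_inv x \<in> F_points M" if "x \<in> F_points M" for x
  proof -
    let ?x = "map_matrix to_ac x"
    have x: "?x \<in> M" using that by (simp add: F_points_def)
    then have "det ?x \<noteq> 0" using inv_mem invertible_det_nz by blast
    then have inv: "invertible x" by (simp add: det_map_matrix_to_ac invertible_det_nz)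
    have "map_matrix to_ac (matrix_inv x) = matrix_inv ?x ** (?x ** map_matrix to_ac (matrix_inv x))"
      using x by simp
    also have "?x ** map_matrix to_ac (matrix_inv x) = mat 1"
      by (simp add: matrix_inv_mult[OF inv] flip: map_matrix_to_ac_mult)
    finally show ?thesis using inv_mem[OF x] inv by (simp add: F_points_def)
  qed
qed

lemma center_of_matrix_group:
  assumes "matrix_group M"
  shows "matrix_group (center_of M)"
proof
  interpret matrix_group M by fact
  have sub: "center_of M \<subseteq> M" unfolding center_of_def by blast
  show "mat 1 \<in> center_of M" by (simp add: center_of_def one_mem)
  show "x ** y \<in> center_of M" if "x \<in> center_of M" "y \<in> center_of M" for x y
  proof -
    have "x ** y ** h = h ** (x ** y)" if "h \<in> M" for h
    proof -
      have "y ** h = h ** y" "x ** h = h ** x"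
        using \<open>x \<in> center_of M\<close> \<open>y \<in> center_of M\<close> that unfolding center_of_def by blast+
      then show ?thesis by (metis matrix_mul_assoc)
    qed
    moreover have "x ** y \<in> M" using that mult_mem sub by blast
    ultimately show ?thesis unfolding center_of_def by blast
  qed
  show "invertible x \<and> matrix_inv x \<in> center_of M" if x: "x \<in> center_of M" for x
  proof -
    have xM: "x \<in> M" using x sub by blast
    have "matrix_inv x ** h = h ** matrix_inv x" if h: "h \<in> M" for h
    proof -
      have "x ** h = h ** x" using x h unfolding center_of_def by blast
      then have "matrix_inv x ** (x ** h) ** matrix_inv x = matrix_inv x ** (h ** x) ** matrix_inv x" by simp
      then show ?thesis using xM by (simp add: mult_inv flip: matrix_mul_assoc)
    qed
    then show ?thesis using inv_mem[OF xM] unfolding center_of_def by blast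
  qed
qed

lemma base_field_closed:
  "0 \<in> base_field" "1 \<in> base_field" "x \<in> base_field \<Longrightarrow> y \<in> base_field \<Longrightarrow> x + y \<in> base_field"
  "x \<in> base_field \<Longrightarrow> y \<in> base_field \<Longrightarrow> x * y \<in> base_field"
  "x \<in> base_field \<Longrightarrow> inverse x \<in> base_field"
  "of_int k \<in> base_field"
  by (metis rangeI to_ac_0, metis rangeI to_ac_1,
      auto simp flip: to_ac_add to_ac_mult to_ac_inverse to_ac_of_int)

lemma base_field_sum: "(\<And>i. i \<in> I \<Longrightarrow> f i \<in> base_field) \<Longrightarrow> sum f I \<in> base_field"
  by (induction I rule: infinite_finite_induct) (simp_all add: base_field_closed)

lemma gen_algebra_base_field:
  assumes "f \<in> gen_algebra base_field S" "\<And>g. g \<in> S \<Longrightarrow> g x \<in> base_field"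
  shows "f x \<in> base_field"
  using assms(1) by induction (auto intro: base_field_closed assms(2))

lemma regular_funs_base_field:
  assumes "f \<in> regular_funs base_field"
  shows "f (map_matrix to_ac m) \<in> base_field"
  using assms unfolding regular_funs_def
  by (rule gen_algebra_base_field) (auto simp: det_map_matrix_to_ac simp flip: to_ac_inverse)

lemma laurent_funs_base_field:
  assumes "f \<in> laurent_funs base_field d" "\<And>l. l < d \<Longrightarrow> t l \<in> base_field"
  shows "f t \<in> base_field"
  using assms(1) unfolding laurent_funs_def
  by (rule gen_algebra_base_field) (use assms(2) base_field_closed(5) in auto)

lemma gen_algebra_sum:
  assumes "0 \<in> R" "\<And>i. i \<in> I \<Longrightarrow> f i \<in> gen_algebra R S"
  shows "(\<lambda>x. \<Sum>i\<in>I. f i x) \<in> gen_algebra R S"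
  using assms(2)
  by (induction I rule: infinite_finite_induct) (auto intro: gen_algebra.intros assms(1))

lemma gen_algebra_prod:
  assumes "1 \<in> R" "\<And>i. i \<in> I \<Longrightarrow> f i \<in> gen_algebra R S"
  shows "(\<lambda>x. \<Prod>i\<in>I. f i x) \<in> gen_algebra R S"
  using assms(2)
  by (induction I rule: infinite_finite_induct) (auto intro: gen_algebra.intros assms(1))

lemma gen_algebra_det:
  fixes B :: "'x \<Rightarrow> 'k::field^'n^'n"
  assumes "range of_int \<subseteq> R" "\<And>i j. (\<lambda>x. B x $ i $ j) \<in> gen_algebra R S"
  shows "(\<lambda>x. det (B x)) \<in> gen_algebra R S"
proof -
  have "0 \<in> R" "1 \<in> R" using assms(1) of_int_0 of_int_1 by (metis rangeI subsetD)+
  then show ?thesis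
    unfolding det_def
    by (intro gen_algebra_sum gen_algebra.mult gen_algebra.const gen_algebra_prod assms(2))
       (use assms(1) in auto)
qed

section \<open>Determinants attached to idempotents\<close>

lemma poly_eqI_nonzero:
  fixes p q :: "'k::field_char_0 poly"
  assumes "\<And>s. s \<noteq> 0 \<Longrightarrow> poly p s = poly q s"
  shows "p = q"
proof (rule ccontr)
  assume "p \<noteq> q"
  then have "finite {s. poly (p - q) s = 0}" by (intro poly_roots_finite) simp
  moreover have "- {0} \<subseteq> {s. poly (p - q) s = 0}" using assms by auto
  ultimately have "finite (- {0 :: 'k})" by (rule finite_subset[rotated])
  then show False using infinite_UNIV_char_0[where 'a = 'k] by (simp add: finite_compl)
qed

text \<open>
  For fixed \<open>y\<close>, the polynomials \<open>R(xy)\<close> and \<open>R(y)R(x)\<close> in \<open>x\<close> coincide; compare leading coefficients.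
\<close>

lemma multiplicative_poly_monomial:
  fixes R :: "'k::field_char_0 poly"
  assumes mult: "\<And>x y. poly R (x * y) = poly R x * poly R y" and "R \<noteq> 0"
  shows "poly R y = y ^ Polynomial.degree R"
proof -
  have "pcompose R [:0, y:] = Polynomial.smult (poly R y) R"
    by (rule poly_eqI_nonzero) (simp add: poly_pcompose mult mult.commute)
  then have "y ^ Polynomial.degree R * Polynomial.coeff R (Polynomial.degree R)
      = poly R y * Polynomial.coeff R (Polynomial.degree R)"
    by (metis Polynomial.coeff_smult coeff_pcompose_linear)
  then show ?thesis using \<open>R \<noteq> 0\<close> by simp
qed

lemma matrix_scale_mult:
  fixes A B :: "'k::comm_ring_1^'n^'n"
  shows "map_matrix ((*) x) A ** B = map_matrix ((*) x) (A ** B)"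
    and "A ** map_matrix ((*) x) B = map_matrix ((*) x) (A ** B)"
  by (simp_all add: vec_eq_iff matrix_matrix_mult_def sum_distrib_left mult_ac)

lemma matrix_diff_distrib:
  fixes A B C :: "'k::comm_ring_1^'n^'n"
  shows "A ** (B - C) = A ** B - A ** C" "(B - C) ** A = B ** A - C ** A"
  by (simp_all add: matrix_matrix_mult_def vec_eq_iff sum_subtractf algebra_simps)

text \<open>
  On the image of \<open>E\<close> the matrix \<open>x E + (1 - E)\<close> acts as \<open>x\<close>, and on the kernel as the identity.  A matrix \<open>y\<close> that
  commutes with \<open>E\<close> preserves both subspaces, so that the actions compose.
\<close>

lemma idempotent_product:
  fixes E :: "'k::comm_ring_1^'n^'n"
  assumes "E ** E = E" "y ** E = E ** y"
  shows "(x ** E + (mat 1 - E)) ** (y ** E + (mat 1 - E)) = x ** y ** E + (mat 1 - E)"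
proof -
  let ?F = "mat 1 - E"
  have EF: "E ** ?F = 0" "?F ** E = 0" "?F ** ?F = ?F"
    by (simp_all add: matrix_diff_distrib assms(1))
  have "x ** E ** (y ** E) = x ** y ** E"
    by (metis assms matrix_mul_assoc)
  moreover have "x ** E ** ?F = 0" 
    by (simp add: EF flip: matrix_mul_assoc)
  moreover have "?F ** (y ** E) = 0"
    by (simp add: assms(2) EF matrix_mul_assoc)
  ultimately show ?thesis
    by (simp add: matrix_add_ldistrib matrix_add_rdistrib EF)
qed

text \<open>
  The exponent is the rank of \<open>E\<close>.  The determinant is a multiplicative polynomial
  in \<open>x\<close>, so it is a power of \<open>x\<close>, and it vanishes at \<open>x = 0\<close> because \<open>1 - E\<close> annihilates the image of \<open>E\<close>.
\<close>

lemma det_idempotent_scaling: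
  fixes E :: "'k::field_char_0^'n^'n"
  assumes idem: "E ** E = E" and "E \<noteq> 0"
  obtains i where "i > 0" "\<And>x. det (map_matrix ((*) x) E + (mat 1 - E)) = x ^ i"
proof -
  define f where "f x = det (map_matrix ((*) x) E + (mat 1 - E))" for x
  define B where "B = (\<chi> i j. [:(mat 1 - E) $ i $ j, E $ i $ j:])"
  define R where "R = det B"
  have Rf: "poly R x = f x" for x
    unfolding R_def f_def det_def by (simp add: poly_sum poly_prod B_def algebra_simps poly_of_int)
  have scale: "map_matrix ((*) x) E = map_matrix ((*) x) (mat 1) ** E" for x
    by (simp add: matrix_scale_mult)
  have mult: "f (x * y) = f x * f y" for x y
  proof -
    have "map_matrix ((*) x) (mat 1) ** map_matrix ((*) y) (mat 1) = (map_matrix ((*) (x * y)) (mat 1) :: 'k^'n^'n)"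
      by (simp add: matrix_scale_mult vec_eq_iff mult_ac)
    moreover have "map_matrix ((*) y) (mat 1) ** E = E ** map_matrix ((*) y) (mat 1)"
      by (simp add: matrix_scale_mult)
    ultimately show ?thesis
      unfolding f_def scale using idempotent_product[OF idem] by (metis det_mul)
  qed
  have f1: "f 1 = 1"
  proof -
    have "map_matrix ((*) 1) E = E" by (simp add: vec_eq_iff)
    then show ?thesis by (simp add: f_def)
  qed
  then have "R \<noteq> 0" using Rf[of 1] by auto
  then have R: "f x = x ^ Polynomial.degree R" for x
    using multiplicative_poly_monomial[of R x] mult by (simp add: Rf)
  have "f 0 = 0"
  proof (rule ccontr)
    assume "f 0 \<noteq> 0"
    have "map_matrix ((*) 0) E = 0" by (simp add: vec_eq_iff)
    then have "f 0 = det (mat 1 - E)" by (simp add: f_def)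
    then have inv: "invertible (mat 1 - E)" using \<open>f 0 \<noteq> 0\<close> by (simp add: invertible_det_nz)
    have "(mat 1 - E) ** E = 0" by (simp add: matrix_diff_distrib idem)
    then have "matrix_inv (mat 1 - E) ** ((mat 1 - E) ** E) = 0" by simp
    then have "E = 0" by (simp add: matrix_mul_assoc matrix_inv_mult[OF inv])
    with \<open>E \<noteq> 0\<close> show False by simp
  qed
  then have "Polynomial.degree R > 0" using R[of 0] by (cases "Polynomial.degree R") auto
  then show ?thesis using R that unfolding f_def by blast
qed

section \<open>Cocharacters with bounded value\<close>

text \<open>
  Clearing the denominator to obtain a genuine polynomial allows the comparison of coefficients.
\<close>

definition laurent_poly_over :: "'k::field set \<Rightarrow> ('k \<Rightarrow> 'k) \<Rightarrow> bool" where
  "laurent_poly_over R f \<longleftrightarrow> (\<exists>N P. (\<forall>r. Polynomial.coeff P r \<in> R) \<and> (\<forall>s. s \<noteq> 0 \<longrightarrow> s ^ N * f s = poly P s))"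

lemma coeff_monom_mult_base:
  assumes "\<forall>r. Polynomial.coeff P r \<in> base_field"
  shows "Polynomial.coeff (Polynomial.monom 1 k * P) r \<in> base_field"
  using assms by (simp add: coeff_monom_mult base_field_closed)

lemma laurent_poly_over_powi:
  "laurent_poly_over base_field (\<lambda>s :: 'f::field alg_closure. s powi k)"
  unfolding laurent_poly_over_def
proof (intro exI conjI allI impI)
  fix r show "Polynomial.coeff (Polynomial.monom 1 (nat (k + int (nat \<bar>k\<bar>))) :: 'f alg_closure poly) r \<in> base_field"
    by (simp add: base_field_closed)
next
  fix s :: "'f alg_closure" assume s: "s \<noteq> 0"
  have "s ^ n * s powi k = s powi (int n + k)" for n
    using s by (simp add: power_int_add)
  then have "s ^ nat \<bar>k\<bar> * s powi k = s powi (int (nat \<bar>k\<bar>) + k)" .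
  also have "\<dots> = s ^ nat (k + int (nat \<bar>k\<bar>))"
    by (simp add: power_int_def add.commute)
  finally show "s ^ nat \<bar>k\<bar> * s powi k = poly (Polynomial.monom 1 (nat (k + int (nat \<bar>k\<bar>)))) s"
    by (simp add: poly_monom)
qed

lemma laurent_poly_over_const:
  assumes "c \<in> base_field"
  shows "laurent_poly_over base_field (\<lambda>s. c)"
  unfolding laurent_poly_over_def
  by (rule exI[of _ 0], rule exI[of _ "[:c:]"])
     (use assms in \<open>auto simp: base_field_closed coeff_pCons split: nat.splits\<close>)

lemma laurent_poly_over_add_mult:
  fixes f g :: "'f::field alg_closure \<Rightarrow> 'f alg_closure"
  assumes "laurent_poly_over base_field f" "laurent_poly_over base_field g"
  shows "laurent_poly_over base_field (\<lambda>s. f s + g s)" "laurent_poly_over base_field (\<lambda>s. f s * g s)"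
proof -
  obtain N P where P: "\<forall>r. Polynomial.coeff P r \<in> base_field" "\<And>s. s \<noteq> 0 \<Longrightarrow> s ^ N * f s = poly P s"
    using assms(1) unfolding laurent_poly_over_def by blast
  obtain N' P' where P': "\<forall>r. Polynomial.coeff P' r \<in> base_field" "\<And>s. s \<noteq> 0 \<Longrightarrow> s ^ N' * g s = poly P' s"
    using assms(2) unfolding laurent_poly_over_def by blast
  show "laurent_poly_over base_field (\<lambda>s. f s + g s)"
    unfolding laurent_poly_over_def
  proof (intro exI conjI allI impI)
    fix r show "Polynomial.coeff (Polynomial.monom 1 N' * P + Polynomial.monom 1 N * P') r \<in> base_field"
      unfolding Polynomial.coeff_add by (intro base_field_closed(3) coeff_monom_mult_base P(1) P'(1))
  next
    fix s :: "'f alg_closure" assume s: "s \<noteq> 0"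
    have "s ^ (N + N') * (f s + g s) = s ^ N' * (s ^ N * f s) + s ^ N * (s ^ N' * g s)"
      by (simp add: algebra_simps power_add)
    then show "s ^ (N + N') * (f s + g s) = poly (Polynomial.monom 1 N' * P + Polynomial.monom 1 N * P') s"
      using P(2)[OF s] P'(2)[OF s] by (simp add: poly_monom)
  qed
  show "laurent_poly_over base_field (\<lambda>s. f s * g s)"
    unfolding laurent_poly_over_def
  proof (intro exI conjI allI impI)
    fix r show "Polynomial.coeff (P * P') r \<in> base_field"
      unfolding coeff_mult using P(1) P'(1) by (intro base_field_sum base_field_closed) auto
  next
    fix s :: "'f alg_closure" assume s: "s \<noteq> 0"
    have "s ^ (N + N') * (f s * g s) = (s ^ N * f s) * (s ^ N' * g s)"
      by (simp add: power_add)
    then show "s ^ (N + N') * (f s * g s) = poly (P * P') s"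
      using P(2)[OF s] P'(2)[OF s] by simp
  qed
qed

lemma laurent_funs_cocharacter:
  assumes "f \<in> laurent_funs base_field d"
  shows "laurent_poly_over base_field (\<lambda>s. f (\<lambda>l\<in>{..<d}. s powi k l))"
  using assms unfolding laurent_funs_def
proof induction
  case (const c)
  then show ?case by (rule laurent_poly_over_const)
next
  case (gen f)
  then consider l where "l < d" "f = (\<lambda>t. t l)" | l where "l < d" "f = (\<lambda>t. inverse (t l))" by blast
  then show ?case
  proof cases
    case 1
    then show ?thesis using laurent_poly_over_powi[of "k l"] by simp
  next
    case 2
    have "inverse (s powi k l) = s powi (- k l)" for s :: "'a alg_closure"
      by (simp add: power_int_minus)
    then show ?thesis using 2 laurent_poly_over_powi[of "- k l"] by simp
  qed
next
  case (add f g)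
  then show ?case by (intro laurent_poly_over_add_mult)
next
  case (mult f g)
  then show ?case by (intro laurent_poly_over_add_mult)
qed

text \<open>
  A single power of \<open>s\<close> clears the denominators of all entries, so that the coefficients of the same degree form matrices.
\<close>

lemma common_denominator:
  fixes L :: "'f::field alg_closure \<Rightarrow> 'f alg_closure^'n^'n"
  assumes "\<And>i j. laurent_poly_over base_field (\<lambda>s. L s $ i $ j)"
  obtains N P where "\<And>i j r. Polynomial.coeff (P i j) r \<in> base_field"
    "\<And>i j s. s \<noteq> 0 \<Longrightarrow> s ^ N * L s $ i $ j = poly (P i j) s"
proof -
  have "\<exists>N P. (\<forall>r. Polynomial.coeff P r \<in> base_field) \<and> (\<forall>s. s \<noteq> 0 \<longrightarrow> s ^ N * L s $ i $ j = poly P s)" for i j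
    using assms[of i j] by (simp add: laurent_poly_over_def)
  then obtain N P where P: "\<And>i j. (\<forall>r. Polynomial.coeff (P i j) r \<in> base_field)"
    "\<And>i j s. s \<noteq> 0 \<Longrightarrow> s ^ N i j * L s $ i $ j = poly (P i j) s"
    by metis
  define N0 where "N0 = (\<Sum>i\<in>UNIV. \<Sum>j\<in>UNIV. N i j)"
  have le: "N i j \<le> N0" for i j
  proof -
    have "N i j \<le> (\<Sum>j\<in>UNIV. N i j)" by (rule member_le_sum) auto
    also have "\<dots> \<le> N0" unfolding N0_def by (rule member_le_sum) auto
    finally show ?thesis .
  qed
  have "s ^ N0 * L s $ i $ j = poly (Polynomial.monom 1 (N0 - N i j) * P i j) s" if "s \<noteq> 0" for i j s
  proof -
    have "s ^ N0 = s ^ (N0 - N i j) * s ^ N i j" using le[of i j] by (simp flip: power_add)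
    then show ?thesis using P(2)[OF that, of i j] by (simp add: poly_monom)
  qed
  moreover have "Polynomial.coeff (Polynomial.monom 1 (N0 - N i j) * P i j) r \<in> base_field" for i j r
    using coeff_monom_mult_base P(1) by blast
  ultimately show ?thesis by (intro that)
qed

text \<open>
  This is the determinant of \<open>m\<close> on the \<open>M\<close>-stable subspace onto which \<open>E\<close> projects.
\<close>

lemma projection_character:
  fixes E :: "'f::field_char_0 alg_closure^'n^'n"
  assumes "matrix_group M" and idem: "E ** E = E"
    and comm: "\<And>m. m \<in> M \<Longrightarrow> m ** E = E ** m" and base: "\<And>i j. E $ i $ j \<in> base_field"
  shows "(\<lambda>m. det (m ** E + (mat 1 - E))) \<in> rational_characters M"
proof -
  interpret matrix_group M by fact
  let ?\<eta> = "\<lambda>m. det (m ** E + (mat 1 - E))"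
  have baseF: "(mat 1 - E) $ i $ j \<in> base_field" for i j
  proof -
    have "(mat 1 - E) $ i $ j = of_int (if i = j then 1 else 0) + of_int (- 1) * E $ i $ j" by (simp add: mat_def)
    then show ?thesis using base base_field_closed by metis
  qed
  have reg: "?\<eta> \<in> regular_funs base_field"
    unfolding regular_funs_def
  proof (rule gen_algebra_det)
    show "range of_int \<subseteq> base_field" using base_field_closed(6) by blast
    fix i j
    have "(\<lambda>m. (\<Sum>k\<in>UNIV. m $ i $ k * E $ k $ j) + (mat 1 - E) $ i $ j)
        \<in> gen_algebra base_field ({\<lambda>g. g $ i $ j |i j. True} \<union> {\<lambda>g. inverse (det g)})"
      by (intro gen_algebra.add gen_algebra_sum gen_algebra.mult gen_algebra.const base baseF base_field_closed gen_algebra.gen) blast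
    then show "(\<lambda>m. (m ** E + (mat 1 - E)) $ i $ j)
        \<in> gen_algebra base_field ({\<lambda>g. g $ i $ j |i j. True} \<union> {\<lambda>g. inverse (det g)})"
      by (simp add: matrix_matrix_mult_def)
  qed
  have mult: "?\<eta> (x ** y) = ?\<eta> x * ?\<eta> y" if "x \<in> M" "y \<in> M" for x y
    using idempotent_product[OF idem comm[OF that(2)], of x] by (metis det_mul)
  have "?\<eta> x \<noteq> 0" if x: "x \<in> M" for x
  proof -
    have "?\<eta> x * ?\<eta> (matrix_inv x) = ?\<eta> (mat 1)"
      using mult[OF x] inv_mem[OF x] mult_inv(1)[OF x] by metis
    also have "\<dots> = 1" by simp
    finally show ?thesis by auto
  qed
  then show ?thesis using reg mult by (simp add: rational_characters_def)
qed

text \<open>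
  Expand \<open>L s\<close> as the sum of \<open>s\<close> to the power \<open>r - N\<close> times \<open>E r\<close>.  Comparing coefficients in \<open>L (s t) = L s L t\<close>
  shows that the \<open>E r\<close> are orthogonal idempotents, the projections onto the weight spaces; they commute with \<open>M\<close>
  and have entries in the base field.  If \<open>E r\<close> is nonzero, then the associated rational character takes at \<open>L q\<close>
  the value \<open>q\<close> to the power \<open>(r - N) i\<close>, with \<open>i > 0\<close>; it can have absolute value \<open>1\<close> only for \<open>r = N\<close>.  So \<open>L\<close> is constant.
\<close>

lemma bounded_cocharacter_trivial:
  fixes M :: "('f::padic_field alg_closure^'n^'n) set"
    and L :: "'f alg_closure \<Rightarrow> 'f alg_closure^'n^'n"
  assumes "matrix_group M"
    and laurent: "\<And>i j. laurent_poly_over base_field (\<lambda>s. L s $ i $ j)"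
    and hom: "\<And>s t. s \<noteq> 0 \<Longrightarrow> t \<noteq> 0 \<Longrightarrow> L (s * t) = L s ** L t" and one: "L 1 = mat 1"
    and comm: "\<And>s m. s \<noteq> 0 \<Longrightarrow> m \<in> M \<Longrightarrow> m ** L s = L s ** m"
    and q: "0 < absF q" "absF q < 1" and mem: "L (to_ac q) \<in> M"
    and bdd: "\<And>\<eta>. \<eta> \<in> rational_characters M \<Longrightarrow> absF (of_ac (\<eta> (L (to_ac q)))) = 1"
    and s: "s \<noteq> 0"
  shows "L s = mat 1"
proof -
  obtain N P where base: "\<And>i j r. Polynomial.coeff (P i j) r \<in> base_field"
    and P: "\<And>i j s. s \<noteq> 0 \<Longrightarrow> s ^ N * L s $ i $ j = poly (P i j) s"
    using common_denominator[OF laurent] by metis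
  define E where "E r = (\<chi> i j. Polynomial.coeff (P i j) r)" for r
  have E_comm: "m ** E r = E r ** m" if m: "m \<in> M" for m r
  proof -
    have "(\<Sum>k\<in>UNIV. Polynomial.smult (m $ i $ k) (P k j)) = (\<Sum>k\<in>UNIV. Polynomial.smult (m $ k $ j) (P i k))" for i j
    proof (rule poly_eqI_nonzero)
      fix s :: "'f alg_closure" assume s: "s \<noteq> 0"
      have "s ^ N * (m ** L s) $ i $ j = s ^ N * (L s ** m) $ i $ j" using comm[OF s m] by simp
      then show "poly (\<Sum>k\<in>UNIV. Polynomial.smult (m $ i $ k) (P k j)) s = poly (\<Sum>k\<in>UNIV. Polynomial.smult (m $ k $ j) (P i k)) s"
        by (simp add: matrix_matrix_mult_def poly_sum sum_distrib_left mult_ac flip: P[OF s])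
    qed
    then have "Polynomial.coeff (\<Sum>k\<in>UNIV. Polynomial.smult (m $ i $ k) (P k j)) r
        = Polynomial.coeff (\<Sum>k\<in>UNIV. Polynomial.smult (m $ k $ j) (P i k)) r" for i j by simp
    then show ?thesis
      by (simp add: vec_eq_iff matrix_matrix_mult_def E_def Polynomial.coeff_sum mult_ac)
  qed
  \<comment> \<open>Coefficients in \<open>s\<close> of \<open>L (s t) = L s L t\<close>, for fixed \<open>t\<close>.\<close>
  have mult1: "t ^ r * Polynomial.coeff (P i j) r = (\<Sum>k\<in>UNIV. Polynomial.coeff (P i k) r * poly (P k j) t)"
    if t: "t \<noteq> 0" for t i j r
  proof -
    have "pcompose (P i j) [:0, t:] = (\<Sum>k\<in>UNIV. Polynomial.smult (poly (P k j) t) (P i k))"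
    proof (rule poly_eqI_nonzero)
      fix s :: "'f alg_closure" assume s: "s \<noteq> 0"
      have "poly (pcompose (P i j) [:0, t:]) s = (s * t) ^ N * L (s * t) $ i $ j"
        using P[of "s * t" i j] s t by (simp add: poly_pcompose mult.commute)
      also have "\<dots> = (\<Sum>k\<in>UNIV. (s ^ N * L s $ i $ k) * (t ^ N * L t $ k $ j))"
        using hom[OF s t] by (simp add: matrix_matrix_mult_def sum_distrib_left power_mult_distrib mult_ac)
      also have "\<dots> = poly (\<Sum>k\<in>UNIV. Polynomial.smult (poly (P k j) t) (P i k)) s"
        by (simp add: P[OF s] P[OF t] poly_sum mult.commute)
      finally show "poly (pcompose (P i j) [:0, t:]) s = poly (\<Sum>k\<in>UNIV. Polynomial.smult (poly (P k j) t) (P i k)) s" .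
    qed
    then have "Polynomial.coeff (pcompose (P i j) [:0, t:]) r = Polynomial.coeff (\<Sum>k\<in>UNIV. Polynomial.smult (poly (P k j) t) (P i k)) r"
      by simp
    then show ?thesis by (simp add: coeff_pcompose_linear Polynomial.coeff_sum mult.commute)
  qed
  \<comment> \<open>Coefficients in \<open>t\<close> of the previous identity.\<close>
  have E_mult: "E r ** E r' = (if r = r' then E r else 0)" for r r'
  proof -
    have "Polynomial.monom (Polynomial.coeff (P i j) r) r = (\<Sum>k\<in>UNIV. Polynomial.smult (Polynomial.coeff (P i k) r) (P k j))" for i j
      by (rule poly_eqI_nonzero) (simp add: poly_monom poly_sum mult1 mult.commute[of "Polynomial.coeff (P i j) r"])
    then have "Polynomial.coeff (Polynomial.monom (Polynomial.coeff (P i j) r) r) r'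
        = Polynomial.coeff (\<Sum>k\<in>UNIV. Polynomial.smult (Polynomial.coeff (P i k) r) (P k j)) r'" for i j
      by simp
    then have eq: "(if r = r' then Polynomial.coeff (P i j) r else 0) = (\<Sum>k\<in>UNIV. Polynomial.coeff (P i k) r * Polynomial.coeff (P k j) r')" for i j
      by (simp add: Polynomial.coeff_sum)
    show ?thesis by (simp add: vec_eq_iff matrix_matrix_mult_def E_def eq[symmetric])
  qed
  have E0: "E r = 0" if "r \<noteq> N" for r
  proof (rule ccontr)
    assume "E r \<noteq> 0"
    then obtain i where i: "i > 0" "\<And>x. det (map_matrix ((*) x) (E r) + (mat 1 - E r)) = x ^ i"
      using det_idempotent_scaling[of "E r"] E_mult[of r r] by auto
    let ?Q = "to_ac q"
    have q0: "q \<noteq> 0" using q by auto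
    have "L ?Q ** E r = map_matrix ((*) (to_ac (q ^ r / q ^ N))) (E r)"
    proof -
      have "?Q ^ N * (L ?Q ** E r) $ i $ j = ?Q ^ r * E r $ i $ j" for i j
      proof -
        have "?Q ^ N * (L ?Q ** E r) $ i $ j = ?Q ^ N * (E r ** L ?Q) $ i $ j"
          using E_comm[OF mem] by simp
        also have "\<dots> = (\<Sum>k\<in>UNIV. Polynomial.coeff (P i k) r * (?Q ^ N * L ?Q $ k $ j))"
          by (simp add: matrix_matrix_mult_def E_def sum_distrib_left mult_ac)
        also have "\<dots> = ?Q ^ r * E r $ i $ j"
          using q0 mult1[of ?Q r i j] by (simp add: P E_def)
        finally show ?thesis .
      qed
      then show ?thesis using q0 by (simp add: vec_eq_iff field_simps)
    qed
    then have "det (L ?Q ** E r + (mat 1 - E r)) = to_ac ((q ^ r / q ^ N) ^ i)"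
      by (simp only: i(2) to_ac_power)
    moreover have "(\<lambda>m. det (m ** E r + (mat 1 - E r))) \<in> rational_characters M"
      using E_mult[of r r] E_comm base by (intro projection_character assms(1)) (auto simp: E_def)
    ultimately have "absF ((q ^ r / q ^ N) ^ i) = 1"
      using bdd by (metis of_ac_to_ac)
    then have "absF (q ^ r / q ^ N) = 1"
      using i(1) power_eq_imp_eq_base[of "absF (q ^ r / q ^ N)" i 1] by (simp add: absF_power)
    then have "absF (q ^ r) = absF (q ^ N)"
      using q0 absF_mult[of "q ^ r / q ^ N" "q ^ N"] by simp
    then have "absF q ^ r = absF q ^ N" by (simp add: absF_power)
    then show False using q \<open>r \<noteq> N\<close> by (metis power_inject_exp' less_irrefl)
  qed
  have const: "L t $ i $ j = Polynomial.coeff (P i j) N" if "t \<noteq> 0" for t i j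
  proof -
    have "Polynomial.coeff (P i j) r = 0" if "r \<noteq> N" for r
      using E0[OF that] by (simp add: E_def vec_eq_iff)
    then have "P i j = Polynomial.monom (Polynomial.coeff (P i j) N) N"
      by (intro poly_eqI) (auto simp: )
    then have "poly (P i j) t = Polynomial.coeff (P i j) N * t ^ N" by (metis poly_monom)
    then show ?thesis using P[OF that, of i j] that by simp
  qed
  have "L s $ i $ j = L 1 $ i $ j" for i j using const[OF s] const[of 1] by simp
  then show ?thesis using one by (simp add: vec_eq_iff)
qed

section \<open>Unramified characters trivial on the centre\<close>

text \<open>
  More than \<open>d\<close> integer vectors of length \<open>d\<close> are linearly dependent over the integers: fraction-free elimination of the
  last coordinate by means of a vector \<open>i0\<close> in which it does not vanish.
\<close>

lemma integer_dependency:
  fixes v :: "'i \<Rightarrow> nat \<Rightarrow> int"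
  assumes "finite I" "card I > d"
  shows "\<exists>c. (\<exists>i\<in>I. c i \<noteq> 0) \<and> (\<forall>l<d. (\<Sum>i\<in>I. c i * v i l) = 0)"
  using assms
proof (induction d arbitrary: I v)
  case 0
  then have "I \<noteq> {}" by auto
  then show ?case by (intro exI[of _ "\<lambda>_. 1"]) auto
next
  case (Suc d)
  show ?case
  proof (cases "\<forall>i\<in>I. v i d = 0")
    case True
    obtain c where c: "\<exists>i\<in>I. c i \<noteq> 0" "\<forall>l<d. (\<Sum>i\<in>I. c i * v i l) = 0"
      using Suc.IH[of I v] Suc.prems by auto
    have "(\<Sum>i\<in>I. c i * v i l) = 0" if "l < Suc d" for l
      using that c(2) True by (cases "l = d") auto
    then show ?thesis using c(1) by blast
  next
    case False
    then obtain i0 where i0: "i0 \<in> I" "v i0 d \<noteq> 0" by blast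
    let ?J = "I - {i0}"
    define w where "w i l = v i0 d * v i l - v i d * v i0 l" for i l
    have "card ?J > d" using Suc.prems i0 by simp
    then obtain c where c: "\<exists>i\<in>?J. c i \<noteq> 0" "\<forall>l<d. (\<Sum>i\<in>?J. c i * w i l) = 0"
      using Suc.IH[of ?J w] Suc.prems by auto
    define e where "e i = (if i = i0 then - (\<Sum>i\<in>?J. c i * v i d) else c i * v i0 d)" for i
    have "(\<Sum>i\<in>I. e i * v i l) = (\<Sum>i\<in>?J. c i * w i l)" for l
    proof -
      have "(\<Sum>i\<in>I. e i * v i l) = e i0 * v i0 l + (\<Sum>i\<in>?J. e i * v i l)"
        using i0 Suc.prems by (simp add: sum.remove)
      also have "(\<Sum>i\<in>?J. e i * v i l) = (\<Sum>i\<in>?J. c i * v i0 d * v i l)"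
        by (intro sum.cong) (auto simp: e_def)
      also have "e i0 * v i0 l = - (\<Sum>i\<in>?J. c i * v i d * v i0 l)"
        by (simp add: e_def sum_distrib_right)
      finally show ?thesis
        by (simp add: w_def sum_subtractf algebra_simps)
    qed
    moreover have "w i d = 0" for i by (simp add: w_def)
    ultimately have "(\<Sum>i\<in>I. e i * v i l) = 0" if "l < Suc d" for l
      using c(2) that by (cases "l = d") auto
    moreover have "\<exists>i\<in>I. e i \<noteq> 0" using c(1) i0 by (auto simp: e_def)
    ultimately show ?thesis by blast
  qed
qed

lemma additive_int_expand:
  fixes g :: "(nat \<Rightarrow> int) \<Rightarrow> int"
  assumes add: "\<And>k k'. g (\<lambda>l. k l + k' l) = g k + g k'"
  shows "g (\<lambda>l. if l < n then k l else 0) = (\<Sum>i<n. k i * g (\<lambda>l. if l = i then 1 else 0))"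
proof (induction n)
  case 0
  have "g (\<lambda>l. 0) = g (\<lambda>l. 0) + g (\<lambda>l. 0)" using add[of "\<lambda>l. 0" "\<lambda>l. 0"] by simp
  then show ?case by simp
next
  case (Suc n)
  have g0: "g (\<lambda>l. 0) = 0" using add[of "\<lambda>l. 0" "\<lambda>l. 0"] by simp
  have nat_multiple: "g (\<lambda>l. if l = n then int m else 0) = int m * g (\<lambda>l. if l = n then 1 else 0)" for m
  proof (induction m)
    case (Suc m)
    have "(\<lambda>l. if l = n then int (Suc m) else 0)
        = (\<lambda>l. (if l = n then int m else 0) + (if l = n then 1 else 0))" by auto
    then show ?case using add[of "\<lambda>l. if l = n then int m else 0" "\<lambda>l. if l = n then 1 else 0"] Suc
      by (simp add: algebra_simps)
  qed (simp add: g0 cong: if_cong)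
  have int_multiple: "g (\<lambda>l. if l = n then z else 0) = z * g (\<lambda>l. if l = n then 1 else 0)" for z
  proof (cases "z \<ge> 0")
    case True
    then show ?thesis using nat_multiple[of "nat z"] by (simp cong: if_cong)
  next
    case False
    have "(\<lambda>l. (if l = n then z else 0) + (if l = n then - z else 0)) = (\<lambda>l. 0)" by auto
    then have "g (\<lambda>l. if l = n then z else 0) + g (\<lambda>l. if l = n then - z else 0) = 0"
      using add[of "\<lambda>l. if l = n then z else 0" "\<lambda>l. if l = n then - z else 0"] g0 by simp
    then show ?thesis using nat_multiple[of "nat (- z)"] False by (simp cong: if_cong)
  qed
  have "(\<lambda>l. if l < Suc n then k l else 0) = (\<lambda>l. (if l < n then k l else 0) + (if l = n then k n else 0))"
    by auto
  then show ?case
    using add[of "\<lambda>l. if l < n then k l else 0" "\<lambda>l. if l = n then k n else 0"] Suc int_multiple[of "k n"] by simp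
qed

lemma ex_absF_between: "\<exists>q :: 'f::padic_field. 0 < absF q \<and> absF q < 1"
proof -
  obtain p :: nat where p: "Factorial_Ring.prime p" "absF (of_nat p :: 'f) < 1" using absF_prime by blast
  have "p \<noteq> 0" using p(1) by (metis not_prime_0)
  then have "absF (of_nat p :: 'f) \<noteq> 0" by simp
  then have "0 < absF (of_nat p :: 'f)" using absF_nonneg[of "of_nat p :: 'f"] by linarith
  then show ?thesis using p(2) by blast
qed

lemma to_ac_powi: "to_ac (q powi k) = to_ac q powi k"
  by (simp add: power_int_def)

lemma powi_eq_1:
  fixes q :: "'f::padic_field"
  assumes "0 < absF q" "absF q < 1" "to_ac q powi k = 1"
  shows "k = 0"
proof (rule ccontr)
  assume "k \<noteq> 0"
  have "q powi k = 1" using assms(3) by (simp flip: to_ac_powi)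
  then have "q ^ nat \<bar>k\<bar> = 1"
    by (auto simp: power_int_def field_simps split: if_splits)
  then have "absF q ^ nat \<bar>k\<bar> = 1" by (metis absF_1 absF_power)
  moreover have "absF q ^ nat \<bar>k\<bar> < 1"
    using assms \<open>k \<noteq> 0\<close> by (intro power_less_one_iff[THEN iffD2]) auto
  ultimately show False by simp
qed

lemma rational_character_mult:
  fixes M :: "('f::padic_field alg_closure^'n^'n) set"
  assumes "\<eta> \<in> rational_characters M" "x \<in> F_points M" "y \<in> F_points M"
  shows "absF (of_ac (\<eta> (map_matrix to_ac (x ** y))))
    = absF (of_ac (\<eta> (map_matrix to_ac x))) * absF (of_ac (\<eta> (map_matrix to_ac y)))"
proof -
  have "\<eta> \<in> regular_funs base_field" using assms(1) by (simp add: rational_characters_def)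
  then obtain u v where uv: "\<eta> (map_matrix to_ac x) = to_ac u" "\<eta> (map_matrix to_ac y) = to_ac v"
    using regular_funs_base_field by (metis rangeE)
  have "\<eta> (map_matrix to_ac (x ** y)) = to_ac u * to_ac v"
    using assms by (simp add: rational_characters_def F_points_def map_matrix_to_ac_mult uv)
  then have "\<eta> (map_matrix to_ac (x ** y)) = to_ac (u * v)" by simp
  then show ?thesis by (simp only: uv of_ac_to_ac absF_mult)
qed

lemma F_points1_normal:
  fixes M :: "('f::padic_field alg_closure^'n^'n) set"
  assumes M: "matrix_group M"
  shows "F_points1 M \<lhd> mat_group (F_points M)"
proof -
  interpret H: matrix_group "F_points M" using F_points_matrix_group[OF M] .
  define val where "val \<eta> x = absF (of_ac (\<eta> (map_matrix to_ac x)))" for \<eta> :: "'f alg_closure^'n^'n \<Rightarrow> 'f alg_closure" and x :: "'f^'n^'n"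
  have H1: "F_points1 M = {x \<in> F_points M. \<forall>\<eta>\<in>rational_characters M. val \<eta> x = 1}"
    by (simp add: F_points1_def val_def)
  have mult: "val \<eta> (x ** y) = val \<eta> x * val \<eta> y"
    if "\<eta> \<in> rational_characters M" "x \<in> F_points M" "y \<in> F_points M" for \<eta> x y
    unfolding val_def using rational_character_mult[OF that] .
  have one: "val \<eta> (mat 1) = 1" if "\<eta> \<in> rational_characters M" for \<eta>
  proof -
    interpret M: matrix_group M by fact
    have "\<eta> (mat 1 ** mat 1) = \<eta> (mat 1) * \<eta> (mat 1)" "\<eta> (mat 1) \<noteq> 0"
      using that M.one_mem unfolding rational_characters_def by blast+
    then show ?thesis by (simp add: val_def)
  qed
  have inv: "val \<eta> x * val \<eta> (matrix_inv x) = 1" if "\<eta> \<in> rational_characters M" "x \<in> F_points M" for \<eta> x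
    using mult[OF that, of "matrix_inv x"] one[OF that(1)] H.mult_inv(1)[OF that(2)] H.inv_mem[OF that(2)] by simp
  have G: "group (mat_group (F_points M))" by (rule H.group_mat_group)
  have invG: "inv\<^bsub>mat_group (F_points M)\<^esub> x = matrix_inv x" if "x \<in> F_points M" for x
    using inv_mat_group[OF F_points_matrix_group[OF M] that] .
  show ?thesis
    unfolding group.normal_inv_iff[OF G]
  proof (intro conjI ballI)
    show "subgroup (F_points1 M) (mat_group (F_points M))"
    proof (rule group.subgroupI[OF G])
      show "F_points1 M \<noteq> {}" using one H.one_mem unfolding H1 by blast
      show "F_points1 M \<subseteq> carrier (mat_group (F_points M))" by (auto simp: H1 mat_group_def)
      fix x assume "x \<in> F_points1 M"
      then have x: "x \<in> F_points M" "\<forall>\<eta>\<in>rational_characters M. val \<eta> x = 1" by (simp_all add: H1)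
      have "val \<eta> (matrix_inv x) = 1" if "\<eta> \<in> rational_characters M" for \<eta>
        using inv[OF that x(1)] x(2) that by simp
      then show "inv\<^bsub>mat_group (F_points M)\<^esub> x \<in> F_points1 M"
        using invG[OF x(1)] H.inv_mem[OF x(1)] by (simp add: H1)
    next
      fix x y assume "x \<in> F_points1 M" "y \<in> F_points1 M"
      then show "x \<otimes>\<^bsub>mat_group (F_points M)\<^esub> y \<in> F_points1 M"
        using H.mult_mem mult by (simp add: H1 mat_group_def)
    qed
    fix x h assume "x \<in> carrier (mat_group (F_points M))" "h \<in> F_points1 M"
    then have x: "x \<in> F_points M" and h: "h \<in> F_points M" "\<forall>\<eta>\<in>rational_characters M. val \<eta> h = 1"
      by (simp_all add: H1 mat_group_def)
    have "val \<eta> (x ** h ** matrix_inv x) = 1" if "\<eta> \<in> rational_characters M" for \<eta>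
      using mult[OF that] inv[OF that x] x h that H.mult_mem H.inv_mem[OF x] by simp
    then show "x \<otimes>\<^bsub>mat_group (F_points M)\<^esub> h \<otimes>\<^bsub>mat_group (F_points M)\<^esub> inv\<^bsub>mat_group (F_points M)\<^esub> x \<in> F_points1 M"
      unfolding invG[OF x] using x h H.mult_mem H.inv_mem[OF x] by (simp add: H1 mat_group_def)
  qed
qed

text \<open>
  The lattice is formed by the points with coordinates \<open>q\<close> to the power \<open>k l\<close>, where \<open>0 < |q| < 1\<close>.  If such a
  point is in \<open>H1\<close>, then the cocharacter \<open>s \<mapsto> \<tau>(s ^ k)\<close> is trivial, and \<open>k = 0\<close> because \<open>\<tau>\<close> is injective.
\<close>

lemma split_torus_lattice:
  fixes M A :: "('f::padic_field alg_closure^'n^'n) set"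
  assumes M: "matrix_group M" and "split_torus A d" and A: "A \<subseteq> center_of M"
  obtains a :: "(nat \<Rightarrow> int) \<Rightarrow> 'f^'n^'n" where
    "\<And>k. a k \<in> F_points (center_of M)"
    "\<And>k k'. a (\<lambda>l. k l + k' l) = a k ** a k'"
    "\<And>k l. a k \<in> F_points1 M \<Longrightarrow> l < d \<Longrightarrow> k l = 0"
proof -
  interpret M: matrix_group M by fact
  let ?D = "PiE {..<d} (\<lambda>_. - {0 :: 'f alg_closure})"
  obtain \<tau> :: "(nat \<Rightarrow> 'f alg_closure) \<Rightarrow> 'f alg_closure^'n^'n" where bij: "bij_betw \<tau> ?D A"
    and hom: "\<forall>s\<in>?D. \<forall>t\<in>?D. \<tau> (\<lambda>l\<in>{..<d}. s l * t l) = \<tau> s ** \<tau> t"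
    and laurent: "\<forall>i j. (\<lambda>t. \<tau> t $ i $ j) \<in> laurent_funs base_field d"
    using assms(2) unfolding split_torus_def by blast
  obtain q :: 'f where q: "0 < absF q" "absF q < 1" using ex_absF_between by blast
  then have Q0: "to_ac q \<noteq> 0" by auto
  define u where "u k s = (\<lambda>l\<in>{..<d}. s powi k l)" for k :: "nat \<Rightarrow> int" and s :: "'f alg_closure"
  define L where "L k s = \<tau> (u k s)" for k s
  have u_D: "u k s \<in> ?D" if "s \<noteq> 0" for k s using that by (auto simp: u_def)
  have L_A: "L k s \<in> A" if "s \<noteq> 0" for k s
    unfolding L_def by (rule bij_betw_apply[OF bij u_D[OF that]])
  have L_mult: "L k (s * t) = L k s ** L k t" if "s \<noteq> 0" "t \<noteq> 0" for k s t
  proof -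
    have "u k (s * t) = (\<lambda>l\<in>{..<d}. u k s l * u k t l)"
      by (auto simp: u_def power_int_mult_distrib fun_eq_iff)
    then show ?thesis
      unfolding L_def by (simp only: hom[rule_format, OF u_D[OF that(1)] u_D[OF that(2)]])
  qed
  have L_add: "L (\<lambda>l. k l + k' l) s = L k s ** L k' s" if "s \<noteq> 0" for k k' s
  proof -
    have "u (\<lambda>l. k l + k' l) s = (\<lambda>l\<in>{..<d}. u k s l * u k' s l)"
      using that by (auto simp: u_def power_int_add fun_eq_iff)
    then show ?thesis
      unfolding L_def by (simp only: hom[rule_format, OF u_D[OF that] u_D[OF that]])
  qed
  have A_M: "A \<subseteq> M" using A unfolding center_of_def by blast
  have L_one: "L k 1 = mat 1" for k
  proof -
    have m: "L k 1 \<in> M" using L_A[of 1 k] A_M by auto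
    have "L k 1 ** L k 1 = L k 1" using L_mult[of 1 1 k] by simp
    then have "matrix_inv (L k 1) ** (L k 1 ** L k 1) = matrix_inv (L k 1) ** L k 1" by simp
    then show ?thesis using m M.mult_inv by simp
  qed
  define a where "a k = map_matrix of_ac (L k (to_ac q))" for k
  have a: "map_matrix to_ac (a k) = L k (to_ac q)" for k
  proof -
    have "L k (to_ac q) $ i $ j \<in> base_field" for i j
      unfolding L_def
      by (rule laurent_funs_base_field[OF laurent[rule_format, of i j]]) (simp add: u_def flip: to_ac_powi)
    then show ?thesis by (simp add: a_def vec_eq_iff to_ac_of_ac)
  qed
  show ?thesis
  proof (rule that)
    show "a k \<in> F_points (center_of M)" for k
      unfolding F_points_def mem_Collect_eq a by (rule subsetD[OF A L_A[OF Q0]])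
    show "a (\<lambda>l. k l + k' l) = a k ** a k'" for k k'
      by (rule map_matrix_to_ac_eq_iff[THEN iffD1]) (simp add: map_matrix_to_ac_mult a L_add[OF Q0])
    show "k l = 0" if k: "a k \<in> F_points1 M" and l: "l < d" for k l
    proof -
      have "L k (to_ac q) = mat 1"
      proof (rule bounded_cocharacter_trivial[OF M _ _ _ _ q _ _ Q0])
        show "laurent_poly_over base_field (\<lambda>s. L k s $ i $ j)" for i j
          unfolding L_def u_def by (rule laurent_funs_cocharacter[OF laurent[rule_format]])
        show "L k (s * t) = L k s ** L k t" if "s \<noteq> 0" "t \<noteq> 0" for s t using L_mult[OF that] .
        show "L k 1 = mat 1" by (rule L_one)
        show "m ** L k s = L k s ** m" if "s \<noteq> 0" "m \<in> M" for s m
        proof -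
          have "L k s \<in> center_of M" using subsetD[OF A L_A[OF that(1)]] .
          then have "L k s ** m = m ** L k s" using that(2) unfolding center_of_def by blast
          then show ?thesis by (rule sym)
        qed
        show "L k (to_ac q) \<in> M" using L_A[OF Q0] A_M by blast
        show "absF (of_ac (\<eta> (L k (to_ac q)))) = 1" if "\<eta> \<in> rational_characters M" for \<eta>
          using k that by (simp add: F_points1_def a)
      qed
      then have "\<tau> (u k (to_ac q)) = \<tau> (u k 1)" using L_one[of k] by (simp add: L_def)
      then have "u k (to_ac q) = u k 1"
        by (rule inj_onD[OF bij_betw_imp_inj_on[OF bij] _ u_D[OF Q0] u_D[OF one_neq_zero]])
      then have "u k (to_ac q) l = u k 1 l" by simp
      then have "to_ac q powi k l = 1" using l by (simp add: u_def)
      then show ?thesis using powi_eq_1[OF q] by blast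
    qed
  qed
qed

text \<open>
  The images in \<open>H / H1\<close>, a free abelian group of rank \<open>d\<close>, of \<open>d\<close> generators \<open>a (e i)\<close> of a lattice in \<open>Z\<close> and of \<open>h\<close>
  satisfy a nontrivial integral relation.  It must involve \<open>h\<close>, as the lattice meets \<open>H1\<close> trivially.  Thus a power
  of \<open>h\<close> with positive exponent \<open>n\<close> lies in \<open>Z H1\<close>, and \<open>\<psi>(h)\<close> is an \<open>n\<close>-th root of unity.
\<close>

lemma unramified_char_unitary:
  fixes M A :: "('f::padic_field alg_closure^'n^'n) set"
  assumes M: "matrix_group M" and tor: "split_torus A d" "A \<subseteq> center_of M"
    and \<theta>: "\<theta> \<in> iso (mat_group (F_points M) Mod F_points1 M) (free_Abelian_group {..<d})"
    and \<psi>: "\<psi> \<in> unramified_chars (F_points M) (F_points1 M)"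
    and triv: "\<And>z. z \<in> F_points (center_of M) \<Longrightarrow> \<psi> z = 1"
    and h: "h \<in> F_points M"
  shows "cmod (\<psi> h) = 1"
proof -
  let ?H = "F_points M" and ?H1 = "F_points1 M"
  let ?G = "mat_group ?H"
  interpret H: matrix_group ?H using F_points_matrix_group[OF M] .
  have G: "group ?G" by (rule H.group_mat_group)
  have N: "?H1 \<lhd> ?G" by (rule F_points1_normal[OF M])
  have sub: "subgroup ?H1 ?G" using N by (simp add: normal_imp_subgroup)
  obtain a :: "(nat \<Rightarrow> int) \<Rightarrow> 'f^'n^'n" where
    a_Z: "\<And>k. a k \<in> F_points (center_of M)"
    and a_add: "\<And>k k'. a (\<lambda>l. k l + k' l) = a k ** a k'"
    and a_H1: "\<And>k l. a k \<in> F_points1 M \<Longrightarrow> l < d \<Longrightarrow> k l = 0"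
    using split_torus_lattice[OF M tor] by metis
  have a_H: "a k \<in> ?H" for k using a_Z[of k] by (auto simp: F_points_def center_of_def)
  define \<Theta> where "\<Theta> m = \<theta> (?H1 #>\<^bsub>?G\<^esub> m)" for m
  have coset: "?H1 #>\<^bsub>?G\<^esub> m \<in> carrier (?G Mod ?H1)" if "m \<in> ?H" for m
    using that by (auto simp: FactGroup_def RCOSETS_def mat_group_def)
  have \<theta>_hom: "\<theta> \<in> hom (?G Mod ?H1) (free_Abelian_group {..<d})" and \<theta>_inj: "inj_on \<theta> (carrier (?G Mod ?H1))"
    using \<theta> by (auto simp: iso_def bij_betw_def)
  have \<Theta>_mult: "\<Theta> (x ** y) = \<Theta> x + \<Theta> y" if "x \<in> ?H" "y \<in> ?H" for x y
  proof -
    have "\<theta> ((?H1 #>\<^bsub>?G\<^esub> x) \<otimes>\<^bsub>?G Mod ?H1\<^esub> (?H1 #>\<^bsub>?G\<^esub> y)) = \<Theta> x + \<Theta> y"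
      using hom_mult[OF \<theta>_hom coset[OF that(1)] coset[OF that(2)]] by (simp add: \<Theta>_def)
    moreover have "(?H1 #>\<^bsub>?G\<^esub> x) \<otimes>\<^bsub>?G Mod ?H1\<^esub> (?H1 #>\<^bsub>?G\<^esub> y) = ?H1 #>\<^bsub>?G\<^esub> (x ** y)"
      using normal.rcos_sum[OF N, of x y] that by (simp add: FactGroup_def mat_group_def)
    ultimately show ?thesis by (simp add: \<Theta>_def)
  qed
  have \<Theta>_ker: "m \<in> ?H1" if m: "m \<in> ?H" and z: "\<And>l. l < d \<Longrightarrow> Poly_Mapping.lookup (\<Theta> m) l = 0" for m
  proof -
    have "Poly_Mapping.keys (\<Theta> m) \<subseteq> {..<d}"
      using hom_in_carrier[OF \<theta>_hom coset[OF m]] by (simp add: \<Theta>_def)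
    then have "\<Theta> m = 0" using z by (metis poly_mapping_eqI lookup_zero in_keys_iff lessThan_iff subsetD)
    moreover have "\<Theta> (mat 1) = 0" using \<Theta>_mult[of "mat 1" "mat 1"] H.one_mem by simp
    ultimately have "?H1 #>\<^bsub>?G\<^esub> m = ?H1 #>\<^bsub>?G\<^esub> (mat 1)"
      using inj_onD[OF \<theta>_inj] coset[OF m] coset[OF H.one_mem] by (simp add: \<Theta>_def)
    also have "\<dots> = ?H1"
      using group.coset_join2[OF G _ sub, of "mat 1"] subgroup.one_closed[OF sub] H.one_mem by (simp add: mat_group_def)
    finally show ?thesis using group.coset_join1[OF G _ _ sub, of m] m by (simp add: mat_group_def)
  qed
  define e where "e i = (\<lambda>l::nat. if l = i then 1 else 0 :: int)" for i
  define v where "v i = Poly_Mapping.lookup (if i < d then \<Theta> (a (e i)) else \<Theta> h)" for i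
  obtain c0 where c0: "\<exists>i\<in>{..d}. c0 i \<noteq> 0" "\<forall>l<d. (\<Sum>i\<le>d. c0 i * v i l) = 0"
    using integer_dependency[of "{..d}" d v] by auto
  \<comment> \<open>Normalize the sign, so that the exponent of \<open>h\<close> is a natural number.\<close>
  define c where "c i = (if c0 d \<ge> 0 then c0 i else - c0 i)" for i
  have c: "\<exists>i\<in>{..d}. c i \<noteq> 0" "c d \<ge> 0"
    using c0(1) by (auto simp: c_def)
  have c_rel: "(\<Sum>i\<le>d. c i * v i l) = 0" if "l < d" for l
    using c0(2) that by (cases "c0 d \<ge> 0") (simp_all add: c_def sum_negf)
  define n where "n = nat (c d)"
  define k where "k = (\<lambda>l. if l < d then c l else 0)"
  have ak: "Poly_Mapping.lookup (\<Theta> (a k)) l = (\<Sum>i<d. c i * v i l)" for l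
  proof -
    have "Poly_Mapping.lookup (\<Theta> (a k)) l = (\<Sum>i<d. c i * Poly_Mapping.lookup (\<Theta> (a (e i))) l)"
      unfolding k_def e_def
      by (rule additive_int_expand[of "\<lambda>k. Poly_Mapping.lookup (\<Theta> (a k)) l"])
         (simp add: a_add \<Theta>_mult a_H lookup_add)
    then show ?thesis by (simp add: v_def)
  qed
  have "\<exists>y\<in>?H. (\<forall>l. Poly_Mapping.lookup (\<Theta> y) l = int j * Poly_Mapping.lookup (\<Theta> h) l) \<and> \<psi> y = \<psi> h ^ j" for j
  proof (induction j)
    case 0
    have "\<Theta> (mat 1) = 0" using \<Theta>_mult[of "mat 1" "mat 1"] H.one_mem by simp
    moreover have "\<psi> (mat 1) = 1"
      using \<psi> subgroup.one_closed[OF sub] by (auto simp: unramified_chars_def mat_group_def)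
    ultimately show ?case using H.one_mem by (intro bexI[of _ "mat 1"]) auto
  next
    case (Suc j)
    then obtain y where y: "y \<in> ?H" "\<forall>l. Poly_Mapping.lookup (\<Theta> y) l = int j * Poly_Mapping.lookup (\<Theta> h) l" "\<psi> y = \<psi> h ^ j"
      by blast
    have "\<psi> (h ** y) = \<psi> h * \<psi> y" using \<psi> h y(1) by (simp add: unramified_chars_def)
    then show ?case using y h \<Theta>_mult[OF h y(1)] H.mult_mem[OF h y(1)]
      by (intro bexI[of _ "h ** y"]) (simp_all add: lookup_add algebra_simps)
  qed
  then obtain y where y: "y \<in> ?H" "\<And>l. Poly_Mapping.lookup (\<Theta> y) l = int n * Poly_Mapping.lookup (\<Theta> h) l" "\<psi> y = \<psi> h ^ n"
    by metis
  have "a k ** y \<in> ?H1"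
  proof (rule \<Theta>_ker)
    show "a k ** y \<in> ?H" using a_H y(1) H.mult_mem by blast
    fix l assume l: "l < d"
    have "(\<Sum>i\<le>d. c i * v i l) = (\<Sum>i<d. c i * v i l) + c d * Poly_Mapping.lookup (\<Theta> h) l"
      by (simp add: v_def flip: lessThan_Suc_atMost)
    then show "Poly_Mapping.lookup (\<Theta> (a k ** y)) l = 0"
      using c_rel[OF l] c(2) by (simp add: \<Theta>_mult a_H y lookup_add ak n_def)
  qed
  then have "\<psi> (a k ** y) = 1" using \<psi> by (simp add: unramified_chars_def)
  moreover have "\<psi> (a k ** y) = \<psi> (a k) * \<psi> y" using \<psi> a_H y(1) by (simp add: unramified_chars_def)
  ultimately have pow: "\<psi> h ^ n = 1" using triv[OF a_Z] y(3) by simp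
  have "n > 0"
  proof (rule ccontr)
    assume "\<not> n > 0"
    then have "c d = 0" using c(2) by (simp add: n_def)
    then have "(\<Sum>i<d. c i * v i l) = 0" if "l < d" for l
      using c_rel[OF that] by (simp flip: lessThan_Suc_atMost)
    then have "a k \<in> ?H1" using \<Theta>_ker[OF a_H, of k] ak by simp
    then have "c i = 0" if "i < d" for i using a_H1[of k i] that by (simp add: k_def)
    then show False using c(1) \<open>c d = 0\<close> by (metis atMost_iff le_neq_implies_less)
  qed
  have "cmod (\<psi> h) ^ n = 1" using pow by (metis norm_one norm_power)
  then show ?thesis using power_eq_imp_eq_base[of "cmod (\<psi> h)" n 1] \<open>n > 0\<close> by simp
qed

section \<open>Unitary twists of discrete series representations\<close>

lemma twist_trivial_on_center:
  assumes T: "clinear_on (rep_space \<pi>) T" "bij_betw T (rep_space \<pi>) (rep_space \<sigma>)"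
    and act: "\<And>m v. m \<in> H \<Longrightarrow> v \<in> rep_space \<pi> \<Longrightarrow> T (rep_act \<pi> m v) = cscale (\<psi> m) (rep_act \<sigma> m (T v))"
    and cc: "has_central_character Z \<omega> \<pi>" "has_central_character Z \<omega> \<sigma>"
    and z: "z \<in> Z" "z \<in> H" "\<omega> z \<noteq> 0" and nz: "w \<in> rep_space \<sigma>" "w \<noteq> 0"
  shows "\<psi> z = 1"
proof -
  have "w \<in> T ` rep_space \<pi>" using nz(1) bij_betw_imp_surj_on[OF T(2)] by simp
  then obtain v where v: "v \<in> rep_space \<pi>" "T v = w" by (metis imageE)
  have "cscale (\<omega> z) w = T (rep_act \<pi> z v)"
    using cc(1) z(1) v T(1) by (simp add: has_central_character_def clinear_on_def)
  also have "\<dots> = cscale (\<psi> z * \<omega> z) w"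
    using act[OF z(2) v(1)] cc(2) z(1) nz(1) v(2) by (simp add: has_central_character_def)
  finally have "\<omega> z = \<psi> z * \<omega> z" using nz(2) cvs.scale_cancel_right by blast
  then show ?thesis using z(3) by simp
qed

lemma unitary_twist_unitary:
  assumes T: "clinear_on (rep_space \<pi>) T" "bij_betw T (rep_space \<pi>) (rep_space \<sigma>)"
    and act: "\<And>m v. m \<in> H \<Longrightarrow> v \<in> rep_space \<pi> \<Longrightarrow> T (rep_act \<pi> m v) = cscale (\<psi> m) (rep_act \<sigma> m (T v))"
    and sub: "cvs.subspace (rep_space \<pi>)"
    and closed: "\<And>m v. m \<in> H \<Longrightarrow> v \<in> rep_space \<sigma> \<Longrightarrow> rep_act \<sigma> m v \<in> rep_space \<sigma>"
    and sub': "cvs.subspace (rep_space \<sigma>)"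
    and uni: "unitary_rep H \<sigma>" and \<psi>: "\<And>m. m \<in> H \<Longrightarrow> cmod (\<psi> m) = 1"
  shows "unitary_rep H \<pi>"
proof -
  obtain B :: "cvec \<Rightarrow> cvec \<Rightarrow> complex" where B: "\<forall>u\<in>rep_space \<sigma>. \<forall>v\<in>rep_space \<sigma>.
        (\<forall>w\<in>rep_space \<sigma>. B (u + v) w = B u w + B v w) \<and>
        (\<forall>c. B (cscale c u) v = c * B u v) \<and>
        B v u = cnj (B u v) \<and>
        (u \<noteq> 0 \<longrightarrow> Re (B u u) > 0) \<and>
        (\<forall>m\<in>H. B (rep_act \<sigma> m u) (rep_act \<sigma> m v) = B u v)"
    using uni unfolding unitary_rep_def by blast
  have TV: "T v \<in> rep_space \<sigma>" if "v \<in> rep_space \<pi>" for v using T(2) that bij_betwE by blast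
  have T0: "T 0 = 0"
  proof -
    have "T (cscale 0 0) = cscale 0 (T 0)" using T(1) cvs.subspace_0[OF sub] unfolding clinear_on_def by blast
    then show ?thesis by simp
  qed
  have B_scale: "B (cscale c u) (cscale c v) = c * cnj c * B u v" if "u \<in> rep_space \<sigma>" "v \<in> rep_space \<sigma>" for c u v
  proof -
    have cv: "cscale c v \<in> rep_space \<sigma>" using cvs.subspace_scale[OF sub' that(2)] .
    have "B (cscale c u) (cscale c v) = c * B u (cscale c v)" using B that(1) cv by blast
    also have "B u (cscale c v) = cnj (B (cscale c v) u)" using B that(1) cv by blast
    also have "B (cscale c v) u = c * B v u" using B that by blast
    also have "cnj (c * B v u) = cnj c * cnj (B v u)" by simp
    also have "cnj (B v u) = B u v" using B that by metis
    finally show ?thesis by simp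
  qed
  show ?thesis
    unfolding unitary_rep_def
  proof (intro exI[of _ "\<lambda>u v. B (T u) (T v)"] ballI conjI allI impI)
    fix u v assume u: "u \<in> rep_space \<pi>" and v: "v \<in> rep_space \<pi>"
    note Tu = TV[OF u] and Tv = TV[OF v]
    show "B (T (u + v)) (T w) = B (T u) (T w) + B (T v) (T w)" if "w \<in> rep_space \<pi>" for w
      using B Tu Tv TV[OF that] T(1) u v unfolding clinear_on_def by metis
    show "B (T (cscale c u)) (T v) = c * B (T u) (T v)" for c
      using B Tu Tv T(1) u unfolding clinear_on_def by metis
    show "B (T v) (T u) = cnj (B (T u) (T v))" using B Tu Tv by blast
    show "Re (B (T u) (T u)) > 0" if "u \<noteq> 0"
    proof -
      have "T u \<noteq> T 0" using that T(2) u cvs.subspace_0[OF sub] by (metis bij_betw_def inj_onD)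
      then show ?thesis using B Tu T0 by metis
    qed
    show "B (T (rep_act \<pi> m u)) (T (rep_act \<pi> m v)) = B (T u) (T v)" if m: "m \<in> H" for m
    proof -
      have "\<psi> m * cnj (\<psi> m) = 1" using \<psi>[OF m] by (simp add: complex_norm_square[symmetric])
      then have "B (T (rep_act \<pi> m u)) (T (rep_act \<pi> m v)) = B (rep_act \<sigma> m (T u)) (rep_act \<sigma> m (T v))"
        using act[OF m] u v B_scale[OF closed[OF m Tu] closed[OF m Tv], of "\<psi> m"] by simp
      then show ?thesis using B Tu Tv m by metis
    qed
  qed
qed

context padic_matrix_group begin

text \<open>
  The point is smoothness.  On elements that fix both \<open>w0\<close> and its preimage the twisting character is trivial,
  so those among them that also fix \<open>l\<close> fix the transported functional.  Together they form the neighbourhood \<open>U\<close>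
  of \<open>1\<close>, which is open by the smoothness of \<open>\<pi>\<close>, \<open>\<sigma>\<close> and \<open>l\<close>.
\<close>

lemma smooth_dual_transport:
  assumes sm: "smooth_rep H \<pi>" "smooth_rep H \<sigma>"
    and T: "clinear_on (rep_space \<pi>) T" "bij_betw T (rep_space \<pi>) (rep_space \<sigma>)"
    and act: "\<And>m v. m \<in> H \<Longrightarrow> v \<in> rep_space \<pi> \<Longrightarrow> T (rep_act \<pi> m v) = cscale (\<psi> m) (rep_act \<sigma> m (T v))"
    and l: "l \<in> smooth_dual H \<pi>"
    and nz: "w0 \<in> rep_space \<sigma>" "w0 \<noteq> 0"
  shows "(\<lambda>w. l (inv_into (rep_space \<pi>) T w)) \<in> smooth_dual H \<sigma>"
proof -
  define S where "S = inv_into (rep_space \<pi>) T"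
  have SV: "S w \<in> rep_space \<pi>" and TS: "T (S w) = w" if "w \<in> rep_space \<sigma>" for w
    using that T(2) unfolding S_def bij_betw_def by (auto simp: inv_into_into f_inv_into_f)
  have ST: "S (T v) = v" if "v \<in> rep_space \<pi>" for v
    using that T(2) unfolding S_def bij_betw_def by (simp add: inv_into_f_f)
  have sub: "cvs.subspace (rep_space \<pi>)" and sub': "cvs.subspace (rep_space \<sigma>)"
    using sm by (simp_all add: smooth_rep_def)
  have closed: "rep_act \<sigma> m w \<in> rep_space \<sigma>" if "m \<in> H" "w \<in> rep_space \<sigma>" for m w
    using sm(2) that by (simp add: smooth_rep_def)
  have S_add: "S (v + w) = S v + S w" if "v \<in> rep_space \<sigma>" "w \<in> rep_space \<sigma>" for v w
  proof -
    have "T (S v + S w) = v + w" using T(1) SV TS that by (simp add: clinear_on_def)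
    then show ?thesis using ST[of "S v + S w"] cvs.subspace_add[OF sub] SV that by metis
  qed
  have S_scale: "S (cscale c w) = cscale c (S w)" if "w \<in> rep_space \<sigma>" for c w
  proof -
    have "T (cscale c (S w)) = cscale c w" using T(1) SV TS that by (simp add: clinear_on_def)
    then show ?thesis using ST[of "cscale c (S w)"] cvs.subspace_scale[OF sub] SV that by metis
  qed
  have l_add: "l (v + w) = l v + l w" if "v \<in> rep_space \<pi>" "w \<in> rep_space \<pi>" for v w
    using l that by (simp add: smooth_dual_def)
  have l_scale: "l (cscale c v) = c * l v" if "v \<in> rep_space \<pi>" for c v
    using l that by (simp add: smooth_dual_def)
  define P where "P m \<longleftrightarrow> (\<forall>w\<in>rep_space \<sigma>. l (S (rep_act \<sigma> m w)) = l (S w))" for m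
  define U where "U = {m \<in> H. \<forall>v\<in>rep_space \<pi>. l (rep_act \<pi> m v) = l v}
    \<inter> {m \<in> H. rep_act \<pi> m (S w0) = S w0} \<inter> {m \<in> H. rep_act \<sigma> m w0 = w0}"
  have U_open: "openin (top_of_set H) U"
    unfolding U_def using l sm SV[OF nz(1)] nz(1)
    by (intro openin_Int) (simp_all add: smooth_dual_def smooth_rep_def)
  have act1: "rep_act \<pi> (mat 1) v = v" if "v \<in> rep_space \<pi>" for v using sm(1) that by (simp add: smooth_rep_def)
  have U_one: "mat 1 \<in> U"
    using one_mem act1 SV[OF nz(1)] sm(2) nz(1) by (simp add: U_def smooth_rep_def)
  have U_P: "P m" if m: "m \<in> U" for m
  proof -
    have mH: "m \<in> H" using m by (simp add: U_def)
    have "w0 = T (rep_act \<pi> m (S w0))" using m TS nz(1) by (simp add: U_def)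
    also have "\<dots> = cscale (\<psi> m) w0" using act[OF mH SV[OF nz(1)]] m TS[OF nz(1)] by (simp add: U_def)
    finally have "cscale (\<psi> m) w0 = cscale 1 w0" by simp
    then have \<psi>: "\<psi> m = 1" using nz(2) cvs.scale_cancel_right by blast
    show ?thesis
      unfolding P_def
    proof
      fix w assume w: "w \<in> rep_space \<sigma>"
      have "T (rep_act \<pi> m (S w)) = rep_act \<sigma> m w" using act[OF mH SV[OF w]] TS[OF w] \<psi> by simp
      moreover have "rep_act \<pi> m (S w) \<in> rep_space \<pi>" using sm(1) mH SV[OF w] by (simp add: smooth_rep_def)
      ultimately have "S (rep_act \<sigma> m w) = rep_act \<pi> m (S w)" using ST by metis
      then show "l (S (rep_act \<sigma> m w)) = l (S w)" using m SV[OF w] by (simp add: U_def)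
    qed
  qed
  have "locally_constant_on H P"
  proof (rule locally_constant_onI_right)
    fix x assume x: "x \<in> H"
    have "P (x ** u) = P x" if u: "u \<in> U" for u
    proof -
      have uH: "u \<in> H" using u by (simp add: U_def)
      have mult: "rep_act \<sigma> (x ** u) w = rep_act \<sigma> x (rep_act \<sigma> u w)" if "w \<in> rep_space \<sigma>" for w
        using sm(2) x uH that by (simp add: smooth_rep_def)
      have Pu: "l (S (rep_act \<sigma> u w)) = l (S w)" if "w \<in> rep_space \<sigma>" for w
        using U_P[OF u] that by (simp add: P_def)
      have surj: "\<exists>w'\<in>rep_space \<sigma>. rep_act \<sigma> u w' = w" if "w \<in> rep_space \<sigma>" for w
      proof (rule bexI)
        have "rep_act \<sigma> u (rep_act \<sigma> (matrix_inv u) w) = rep_act \<sigma> (u ** matrix_inv u) w"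
          using sm(2) uH inv_mem that by (simp add: smooth_rep_def)
        then show "rep_act \<sigma> u (rep_act \<sigma> (matrix_inv u) w) = w"
          using mult_inv(1)[OF uH] sm(2) that by (simp add: smooth_rep_def)
      qed (use closed inv_mem uH that in blast)
      show ?thesis
      proof
        assume A: "P (x ** u)"
        show "P x" unfolding P_def
        proof
          fix w assume "w \<in> rep_space \<sigma>"
          then obtain w' where w': "w' \<in> rep_space \<sigma>" "rep_act \<sigma> u w' = w" using surj by blast
          then have "l (S (rep_act \<sigma> x w)) = l (S w')" using A mult unfolding P_def by metis
          then show "l (S (rep_act \<sigma> x w)) = l (S w)" using Pu w' by metis
        qed
      next
        assume A: "P x"
        show "P (x ** u)" unfolding P_def
        proof
          fix w assume w: "w \<in> rep_space \<sigma>"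
          then have "l (S (rep_act \<sigma> (x ** u) w)) = l (S (rep_act \<sigma> u w))"
            using A mult closed[OF uH w] unfolding P_def by metis
          then show "l (S (rep_act \<sigma> (x ** u) w)) = l (S w)" using Pu[OF w] by simp
        qed
      qed
    qed
    then show "\<exists>U. openin (top_of_set H) U \<and> mat 1 \<in> U \<and> (\<forall>u\<in>U. P (x ** u) = P x)"
      using U_open U_one by blast
  qed
  then have "openin (top_of_set H) {m \<in> H. P m = True}"
    unfolding locally_constant_on_iff by blast
  then show ?thesis
    using S_add S_scale l_add l_scale SV
    unfolding smooth_dual_def mem_Collect_eq P_def S_def[symmetric] by simp
qed

end

context central_quotient begin

text \<open>
  The intertwining operator transports the hermitian form, and it matches matrix coefficients up to
  the factor \<open>\<psi>\<close>, which has absolute value \<open>1\<close>.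
\<close>

lemma disc_reps_unitary_twist:
  assumes quot: "quotient_measure H Z \<mu> \<nu> \<kappa>" and \<sigma>: "\<sigma> \<in> disc_reps H Z \<kappa> \<omega>"
    and \<pi>: "irreducible_rep H \<pi>" "has_central_character Z \<omega> \<pi>"
    and eq: "equivalent H \<pi> (twist \<sigma> \<psi>)"
    and omega: "\<And>z. z \<in> Z \<Longrightarrow> \<omega> z \<noteq> 0"
    and unitary: "\<forall>z\<in>Z. \<psi> z = 1 \<Longrightarrow> \<forall>m\<in>H. cmod (\<psi> m) = 1"
  shows "\<pi> \<in> disc_reps H Z \<kappa> \<omega>"
proof -
  obtain T where T: "clinear_on (rep_space \<pi>) T" "bij_betw T (rep_space \<pi>) (rep_space \<sigma>)"
    and act: "\<And>m v. m \<in> H \<Longrightarrow> v \<in> rep_space \<pi> \<Longrightarrow> T (rep_act \<pi> m v) = cscale (\<psi> m) (rep_act \<sigma> m (T v))"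
    using eq unfolding equivalent_def twist_def by auto
  have irr: "irreducible_rep H \<sigma>" and uni: "unitary_rep H \<sigma>" and cc: "has_central_character Z \<omega> \<sigma>"
    and L2: "\<And>c. c \<in> matrix_coefficients H \<sigma> \<Longrightarrow> Lp_mod_center \<kappa> 2 c"
    using \<sigma> by (auto simp: disc_reps_def)
  have sm: "smooth_rep H \<pi>" "smooth_rep H \<sigma>" using irr \<pi>(1) by (simp_all add: irreducible_rep_def)
  have sub: "cvs.subspace (rep_space \<pi>)" "cvs.subspace (rep_space \<sigma>)"
    using sm by (simp_all add: smooth_rep_def)
  have "rep_space \<sigma> \<noteq> {0}" using irr by (simp add: irreducible_rep_def)
  then obtain w0 where w0: "w0 \<in> rep_space \<sigma>" "w0 \<noteq> 0"
    using cvs.subspace_0[OF sub(2)] by blast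
  have "\<psi> z = 1" if "z \<in> Z" for z
    using twist_trivial_on_center[OF T act \<pi>(2) cc that _ omega[OF that] w0] Z_sub that by blast
  then have \<psi>: "cmod (\<psi> m) = 1" if "m \<in> H" for m using unitary that by blast
  have closed: "rep_act \<sigma> m v \<in> rep_space \<sigma>" if "m \<in> H" "v \<in> rep_space \<sigma>" for m v
    using sm(2) that by (simp add: smooth_rep_def)
  have "unitary_rep H \<pi>"
    by (rule unitary_twist_unitary[OF T act sub(1) closed sub(2) uni \<psi>])
  moreover have "Lp_mod_center \<kappa> 2 c" if coeff: "c \<in> matrix_coefficients H \<pi>" for c
  proof -
    obtain l v where l: "l \<in> smooth_dual H \<pi>" and v: "v \<in> rep_space \<pi>" and c: "c = (\<lambda>m. l (rep_act \<pi> m v))"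
      using coeff unfolding matrix_coefficients_def by blast
    define S where "S = inv_into (rep_space \<pi>) T"
    define c' where "c' m = l (S (rep_act \<sigma> m (T v)))" for m
    have Tv: "T v \<in> rep_space \<sigma>" using T(2) v bij_betwE by blast
    have "(\<lambda>w. l (S w)) \<in> smooth_dual H \<sigma>"
      unfolding S_def by (rule smooth_dual_transport[OF sm T act l w0])
    then have "c' \<in> matrix_coefficients H \<sigma>"
      unfolding matrix_coefficients_def c'_def[abs_def] using Tv
      by (intro CollectI exI[of _ "\<lambda>w. l (S w)"] exI[of _ "T v"] conjI refl)
    then have fin: "Lp_mod_center \<kappa> 2 c'" by (rule L2)
    have "cmod (c m) = cmod (c' m)" if m: "m \<in> H" for m
    proof -
      have Sw: "S (rep_act \<sigma> m (T v)) \<in> rep_space \<pi>" "T (S (rep_act \<sigma> m (T v))) = rep_act \<sigma> m (T v)"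
        using closed[OF m Tv] T(2) unfolding S_def bij_betw_def by (auto simp: inv_into_into f_inv_into_f)
      have "T (rep_act \<pi> m v) = T (cscale (\<psi> m) (S (rep_act \<sigma> m (T v))))"
        using act[OF m v] Sw T(1) by (simp add: clinear_on_def)
      moreover have "rep_act \<pi> m v \<in> rep_space \<pi>" using sm(1) m v by (simp add: smooth_rep_def)
      ultimately have "rep_act \<pi> m v = cscale (\<psi> m) (S (rep_act \<sigma> m (T v)))"
        using T(2) cvs.subspace_scale[OF sub(1) Sw(1)] unfolding bij_betw_def by (meson inj_onD)
      then have "c m = \<psi> m * c' m" using l Sw(1) by (simp add: c c'_def smooth_dual_def)
      then show ?thesis using \<psi>[OF m] by (simp add: norm_mult)
    qed
    moreover have "coset_rep C \<in> H" if "C \<in> space \<kappa>" for C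
      using coset_rep_in(3) that quot by (simp add: quotient_measure_def)
    ultimately have "(\<integral>\<^sup>+ C. ennreal (cmod (c (coset_rep C)) powr 2) \<partial>\<kappa>)
        = (\<integral>\<^sup>+ C. ennreal (cmod (c' (coset_rep C)) powr 2) \<partial>\<kappa>)"
      by (intro nn_integral_cong) simp
    then show ?thesis using fin by (simp add: Lp_mod_center_def)
  qed
  ultimately show ?thesis using \<pi> by (simp add: disc_reps_def)
qed

end

lemma in_own_twist_orbit:
  assumes "smooth_rep H \<pi>" "equivalent H \<pi> \<sigma>"
  shows "\<pi> \<in> twist_orbit H H1 \<sigma>"
proof -
  have "twist \<sigma> (\<lambda>_. 1) = \<sigma>" by (simp add: twist_def)
  moreover have "(\<lambda>_. 1) \<in> unramified_chars H H1" by (simp add: unramified_chars_def)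
  ultimately show ?thesis using assms unfolding twist_orbit_def by force
qed

lemma equivalent_refl: "equivalent H \<sigma> \<sigma>"
  unfolding equivalent_def clinear_on_def by (intro exI[of _ "\<lambda>v. v"]) (simp add: bij_betw_def)

section \<open>Projections of generalized pseudo-coefficients\<close>

theorem proposition3p19:
  fixes G P0 M0 M A :: "('f::padic_field alg_closure ^ 'n ^ 'n) set"
    and d :: nat
    and H H1 Z :: "('f ^ 'n ^ 'n) set"
    and \<mu> \<nu> :: "('f ^ 'n ^ 'n) measure"
    and \<kappa> :: "('f ^ 'n ^ 'n) set measure"
    and \<omega> \<phi> :: "'f ^ 'n ^ 'n \<Rightarrow> complex"
    and \<sigma> :: "('f ^ 'n ^ 'n) rep"
    and \<xi> :: "('f ^ 'n ^ 'n) rep \<Rightarrow> complex"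
  assumes "connected_reductive G"
    and "standard_F_levi G P0 M0 M"
    and "split_component M A d"
    and "H = F_points M" and "H1 = F_points1 M" and "Z = F_points (center_of M)"
    and "haar_measure H \<mu>" and "haar_measure Z \<nu>" and "quotient_measure H Z \<mu> \<nu> \<kappa>"
    and "unitary_character Z \<omega>"
    and "\<sigma> \<in> disc_reps H Z \<kappa> \<omega>"
    and "regular_on_orbit H H1 d \<sigma> \<xi>"
    and "\<And>\<pi>. \<pi> \<in> twist_orbit H H1 \<sigma> \<Longrightarrow> \<pi> \<in> disc_reps H Z \<kappa> \<omega> \<Longrightarrow> \<not> equivalent H \<pi> \<sigma> \<Longrightarrow> \<xi> \<pi> = 0"
    and "\<xi> \<sigma> = 1"
    and "generalized_pseudo_coefficient H H1 Z \<mu> \<kappa> \<sigma> \<xi> \<phi>"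
  shows "pseudo_coefficient H Z \<kappa> \<omega> \<sigma> (\<lambda>m. \<integral>z. \<omega> z * \<phi> (z ** m) \<partial>\<nu>)"
proof -
  have M: "matrix_group M"
    using assms(2) alg_subgroup_matrix_group unfolding standard_F_levi_def F_levi_def by blast
  have tor: "split_torus A d" "A \<subseteq> center_of M" using assms(3) by (simp_all add: split_component_def)
  have HG: "matrix_group H" unfolding assms(4) by (rule F_points_matrix_group[OF M])
  have ZG: "matrix_group Z" unfolding assms(6) by (rule F_points_matrix_group[OF center_of_matrix_group[OF M]])
  have Z_H: "Z \<subseteq> H" unfolding assms(4,6) F_points_def center_of_def by blast
  have comm: "z ** h = h ** z" if "z \<in> Z" "h \<in> H" for z h
  proof -
    have "map_matrix to_ac z ** map_matrix to_ac h = map_matrix to_ac h ** map_matrix to_ac z"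
      using that unfolding assms(4,6) F_points_def center_of_def by blast
    then show ?thesis by (simp only: map_matrix_to_ac_eq_iff flip: map_matrix_to_ac_mult)
  qed
  interpret central_quotient H Z
    by (intro central_quotient.intro padic_matrix_group.intro HG ZG central_quotient_axioms.intro Z_H comm)
  have phi: "\<phi> \<in> Cc_inf H" using assms(15) by (simp add: generalized_pseudo_coefficient_def)
  have \<omega>_nz: "\<omega> z \<noteq> 0" if "z \<in> Z" for z
    using assms(10) that by (metis norm_zero unitary_character_def zero_neq_one)
  have proj: "central_projection \<nu> \<omega> \<phi> = (\<lambda>m. \<integral>z. \<omega> z * \<phi> (z ** m) \<partial>\<nu>)"
    by (rule ext) (rule central_projection_def[OF assms(8,10) phi])
  have irr_\<sigma>: "irreducible_rep H \<sigma>" using assms(11) by (simp add: disc_reps_def)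
  have \<sigma>_orbit: "\<sigma> \<in> twist_orbit H H1 \<sigma>"
  proof (rule in_own_twist_orbit[OF _ equivalent_refl])
    show "smooth_rep H \<sigma>" using irr_\<sigma> by (simp add: irreducible_rep_def)
  qed
  obtain \<theta> where \<theta>: "\<theta> \<in> iso (mat_group H Mod H1) (free_Abelian_group {..<d})"
    using assms(12) unfolding regular_on_orbit_def by blast
  have "trace_rep_mod \<kappa> \<pi> (\<lambda>m. \<integral>z. \<omega> z * \<phi> (z ** m) \<partial>\<nu>) = (if equivalent H \<pi> \<sigma> then 1 else 0)"
    if "\<pi> \<in> temp_reps_char H Z \<kappa> \<omega>" for \<pi>
  proof -
    have temp: "\<pi> \<in> temp_reps H Z \<kappa>" and cc: "has_central_character Z \<omega> \<pi>" and irr: "irreducible_rep H \<pi>"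
      using that by (auto simp: temp_reps_char_def temp_reps_def)
    then have sm: "smooth_rep H \<pi>" by (simp add: irreducible_rep_def)
    have "trace_rep_mod \<kappa> \<pi> (\<lambda>m. \<integral>z. \<omega> z * \<phi> (z ** m) \<partial>\<nu>) = trace_rep \<mu> \<pi> \<phi>"
      using trace_central_projection[OF assms(8,10) phi assms(7,9) sm cc] unfolding proj .
    also have "\<dots> = (if \<pi> \<in> twist_orbit H H1 \<sigma> then \<xi> \<pi> else 0)"
      using assms(15) temp by (simp add: generalized_pseudo_coefficient_def)
    also have "\<dots> = (if equivalent H \<pi> \<sigma> then 1 else 0)"
    proof (cases "equivalent H \<pi> \<sigma>")
      case True
      then have orb: "\<pi> \<in> twist_orbit H H1 \<sigma>" using in_own_twist_orbit[OF sm] by blast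
      then have "\<xi> \<pi> = \<xi> \<sigma>" using assms(12) \<sigma>_orbit True unfolding regular_on_orbit_def by blast
      then show ?thesis using True orb assms(14) by simp
    next
      case False
      have "\<xi> \<pi> = 0" if orb: "\<pi> \<in> twist_orbit H H1 \<sigma>"
      proof -
        obtain \<psi> where \<psi>: "\<psi> \<in> unramified_chars H H1" "equivalent H \<pi> (twist \<sigma> \<psi>)"
          using orb unfolding twist_orbit_def by blast
        have "\<forall>m\<in>H. cmod (\<psi> m) = 1" if "\<forall>z\<in>Z. \<psi> z = 1"
          using unramified_char_unitary[OF M tor, of \<theta> \<psi>] \<theta> \<psi>(1) that unfolding assms(4,5,6) by blast
        then have "\<pi> \<in> disc_reps H Z \<kappa> \<omega>"
          using disc_reps_unitary_twist[OF assms(9,11) irr cc \<psi>(2) \<omega>_nz] by blast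
        then show ?thesis using assms(13) orb False by blast
      qed
      then show ?thesis using False by simp
    qed
    finally show ?thesis .
  qed
  moreover have "(\<lambda>m. \<integral>z. \<omega> z * \<phi> (z ** m) \<partial>\<nu>) \<in> Cc_inf_mod H Z \<omega>"
    using central_projection_Cc_inf_mod[OF assms(8,10) phi] unfolding proj .
  ultimately show ?thesis unfolding pseudo_coefficient_def by blast
qed

end
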